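(* Let $G$ be a 2-connected undirected graph with $n=|V(G)|$ vertices. A minimal description of the spanning trees polytope $P(G)$ is the set of all $x\in\mathbb{R}^{E(G)}$ satisfying the following constraints: $x(P)\leq 1$ for any essential parallel closure $P$ of $G$; $x(S)\geq |S|-1$ for any essential coparallel closure $S$ of $G$; $x(E(H))\leq n_H-1$ for any locked subgraph $H$ of $G$; $x(E(G))=n-1$.
   Context: Graphs are finite and undirected, and parallel edges are allowed. $P(G)$ is the convex hull in $\mathbb{R}^{E(G)}$ of the characteristic vectors of all spanning trees of $G$. For $x\in\mathbb{R}^{E(G)}$ and $F\subseteq E(G)$, $x(F)=\sum_{e\in F}x(e)$. For a subgraph $H$, $n_H=|V(H)|$. A description of a polytope by a system of linear equations and inequalities is minimal if the polytope is exactly the solution set of the system and no constraint can be removed without changing the solution set (so the inequalities describe the facets). A matroid $M$ on $E$ with rank function $r$ is disconnected if there is a proper nonempty subset $X\subset E$ with $r(E)=r(X)+r(E\backslash X)$; otherwise it is 2-connected. $M^*$ is the dual matroid, with rank function $r^*$; $M|X$, $M\backslash X$, $M/X$ denote restriction, deletion and contraction. A parallel closure of $M$ is a maximal subset $P\subseteq E$ with $r(P)=1$ and $r(\{e\})=1$ for every $e\in P$. A coparallel closure of $M$ is a parallel closure of $M^*$. For a 2-connected matroid $M$, a parallel closure $P$ is essential if $M/P$ is 2-connected, and a coparallel closure $S$ is essential if $M\backslash S$ is 2-connected. A subset $L\subset E$ is a locked subset of the 2-connected matroid $M$ if $M|L$ and $M^*|(E\backslash L)$ are both 2-connected and $\min\{r(L),r^*(E\backslash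 L)\}\geq 2$. $M(G)$ is the graphical matroid of $G$: its ground set is $E(G)$ and its bases are the spanning trees of $G$. A graph is 2-connected in the sense that corresponds to 2-connectedness of its graphical matroid. (Essential) parallel and coparallel closures of $G$ are those of $M(G)$. In graph terms, a parallel closure is the edge set of an induced subgraph on two vertices; a coparallel closure is a series closure, i.e. a maximal set of edges forming a simple path all of whose vertices except the two terminals have degree 2; essential means that contracting (respectively, deleting) it keeps the graph 2-connected. A locked subgraph of $G$ is a subgraph $H$ for which $E(H)$ is a locked subset of $M(G)$.
   Formalization: Two vertices joined by two edges are excluded; if an essential parallel closure has an essential coparallel complement, the two equivalent constraints count once; the empty matroid is not 2-connected (so E itself is never essential); locked subgraphs have no isolated vertices. *)

theory Defs
  imports "HOL-Analysis.Analysis"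
begin

section \<open>Matroids\<close>

text \<open>A matroid is given by its ground set and its set of bases. The basis axioms are not
  imposed by the type: every matroid below is obtained from a graphical matroid by the
  operations of this section.\<close>

record 'e matroid =
  ground :: "'e set"
  bases :: "'e set set"

definition mrank :: "'e matroid \<Rightarrow> 'e set \<Rightarrow> nat" where
  "mrank M X = Max ((\<lambda>B. card (B \<inter> X)) ` bases M)"

definition dual :: "'e matroid \<Rightarrow> 'e matroid" where
  "dual M = \<lparr>ground = ground M, bases = {ground M - B | B. B \<in> bases M}\<rparr>"

definition restriction :: "'e matroid \<Rightarrow> 'e set \<Rightarrow> 'e matroid" where
  "restriction M X =
     \<lparr>ground = X, bases = {B \<inter> X | B. B \<in> bases M \<and> card (B \<inter> X) = mrank M X}\<rparr>"

definition deletion :: "'e matroid \<Rightarrow> 'e set \<Rightarrow> 'e matroid" where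
  "deletion M X = restriction M (ground M - X)"

definition contraction :: "'e matroid \<Rightarrow> 'e set \<Rightarrow> 'e matroid" where
  "contraction M X = dual (deletion (dual M) X)"

definition disconnected :: "'e matroid \<Rightarrow> bool" where
  "disconnected M \<longleftrightarrow>
     (\<exists>X. X \<noteq> {} \<and> X \<subset> ground M \<and> mrank M (ground M) = mrank M X + mrank M (ground M - X))"

text \<open>The matroid on the empty set is not counted as 2-connected. Thus a (co)parallel closure
  that is the whole ground set is not essential; its constraint would only repeat one half of
  the equation x(E(G)) = n - 1.\<close>

definition two_connected :: "'e matroid \<Rightarrow> bool" where
  "two_connected M \<longleftrightarrow> ground M \<noteq> {} \<and> \<not> disconnected M"

definition parallel_set :: "'e matroid \<Rightarrow> 'e set \<Rightarrow> bool" where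
  "parallel_set M P \<longleftrightarrow> P \<subseteq> ground M \<and> mrank M P = 1 \<and> (\<forall>e\<in>P. mrank M {e} = 1)"

definition parallel_closure :: "'e matroid \<Rightarrow> 'e set \<Rightarrow> bool" where
  "parallel_closure M P \<longleftrightarrow> parallel_set M P \<and> (\<forall>Q. parallel_set M Q \<and> P \<subseteq> Q \<longrightarrow> Q = P)"

definition coparallel_closure :: "'e matroid \<Rightarrow> 'e set \<Rightarrow> bool" where
  "coparallel_closure M S \<longleftrightarrow> parallel_closure (dual M) S"

definition essential_parallel_closure :: "'e matroid \<Rightarrow> 'e set \<Rightarrow> bool" where
  "essential_parallel_closure M P \<longleftrightarrow> parallel_closure M P \<and> two_connected (contraction M P)"

definition essential_coparallel_closure :: "'e matroid \<Rightarrow> 'e set \<Rightarrow> bool" where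
  "essential_coparallel_closure M S \<longleftrightarrow> coparallel_closure M S \<and> two_connected (deletion M S)"

definition locked :: "'e matroid \<Rightarrow> 'e set \<Rightarrow> bool" where
  "locked M L \<longleftrightarrow>
     L \<subset> ground M \<and>
     two_connected (restriction M L) \<and>
     two_connected (restriction (dual M) (ground M - L)) \<and>
     min (mrank M L) (mrank (dual M) (ground M - L)) \<ge> 2"

section \<open>Graphs\<close>

record ('v, 'e) multigraph =
  verts :: "'v set"
  edges :: "'e set"
  ends :: "'e \<Rightarrow> 'v set"

definition multigraph :: "('v, 'e) multigraph \<Rightarrow> bool" where
  "multigraph G \<longleftrightarrow>
     finite (verts G) \<and> finite (edges G) \<and>
     (\<forall>e\<in>edges G. ends G e \<subseteq> verts G \<and> card (ends G e) = 2)"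

definition adjacency :: "('v, 'e) multigraph \<Rightarrow> ('v \<times> 'v) set" where
  "adjacency G = {(u, v). \<exists>e\<in>edges G. ends G e = {u, v}}"

definition connected_graph :: "('v, 'e) multigraph \<Rightarrow> bool" where
  "connected_graph G \<longleftrightarrow> verts G \<noteq> {} \<and> (\<forall>u\<in>verts G. \<forall>v\<in>verts G. (u, v) \<in> (adjacency G)\<^sup>*)"

text \<open>The edges of a cycle are listed cyclically; a pair of parallel edges is a cycle of
  length 2.\<close>

definition is_cycle :: "('v, 'e) multigraph \<Rightarrow> 'e set \<Rightarrow> bool" where
  "is_cycle G C \<longleftrightarrow>
     C \<subseteq> edges G \<and>
     (\<exists>vs es. es \<noteq> [] \<and> length vs = length es \<and> distinct vs \<and> distinct es \<and> set es = C \<and>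
        (\<forall>i<length es. ends G (es ! i) = {vs ! i, vs ! (Suc i mod length es)}))"

definition spanning_tree :: "('v, 'e) multigraph \<Rightarrow> 'e set \<Rightarrow> bool" where
  "spanning_tree G T \<longleftrightarrow>
     T \<subseteq> edges G \<and> connected_graph (G\<lparr>edges := T\<rparr>) \<and> (\<nexists>C. is_cycle (G\<lparr>edges := T\<rparr>) C)"

definition graphical_matroid :: "('v, 'e) multigraph \<Rightarrow> 'e matroid" where
  "graphical_matroid G = \<lparr>ground = edges G, bases = {T. spanning_tree G T}\<rparr>"

definition two_connected_graph :: "('v, 'e) multigraph \<Rightarrow> bool" where
  "two_connected_graph G \<longleftrightarrow> connected_graph G \<and> two_connected (graphical_matroid G)"

definition subgraph :: "('v, 'e) multigraph \<Rightarrow> ('v, 'e) multigraph \<Rightarrow> bool" where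
  "subgraph H G \<longleftrightarrow>
     multigraph H \<and> verts H \<subseteq> verts G \<and> edges H \<subseteq> edges G \<and>
     (\<forall>e\<in>edges H. ends H e = ends G e)"

text \<open>A locked subgraph is taken without isolated vertices, so that it is determined by its edge set and
  its number of vertices exceeds the rank of its edge set by one.\<close>

definition locked_subgraph :: "('v, 'e) multigraph \<Rightarrow> ('v, 'e) multigraph \<Rightarrow> bool" where
  "locked_subgraph H G \<longleftrightarrow>
     subgraph H G \<and> verts H = (\<Union>e\<in>edges H. ends H e) \<and>
     locked (graphical_matroid G) (edges H)"

section \<open>The spanning trees polytope and its constraints\<close>

text \<open>The space indexed by E(G) is \<open>real ^ 'e\<close>: the statement is about graphs whose
  edges are all the elements of the finite type \<open>'e\<close>.\<close>

definition esum :: "real ^ 'e \<Rightarrow> 'e set \<Rightarrow> real" where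
  "esum x F = (\<Sum>e\<in>F. x $ e)"

definition spanning_trees_polytope :: "('v, 'e::finite) multigraph \<Rightarrow> (real ^ 'e) set" where
  "spanning_trees_polytope G = convex hull {(\<chi> e. indicat_real T e) | T. spanning_tree G T}"

text \<open>A constraint is represented by the half-space or hyperplane of its solutions. A
  description is a family \<open>Q\<close> of equations and a family \<open>I\<close> of inequalities.\<close>

definition minimal_description :: "'a set set \<Rightarrow> 'a set set \<Rightarrow> 'a set \<Rightarrow> bool" where
  "minimal_description Q I P \<longleftrightarrow>
     \<Inter>(Q \<union> I) = P \<and> (\<forall>C\<in>Q. \<Inter>((Q - {C}) \<union> I) \<noteq> P) \<and> (\<forall>C\<in>I. \<Inter>(Q \<union> (I - {C})) \<noteq> P)"

text \<open>Inequalities that agree on the solution set of the equations describe the same face.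
  The following predicate says that \<open>J\<close> lists each inequality of \<open>I\<close> exactly once, up to this
  identification.\<close>

definition lists_once :: "'a set set \<Rightarrow> 'a set set \<Rightarrow> 'a set set \<Rightarrow> bool" where
  "lists_once Q I J \<longleftrightarrow> J \<subseteq> I \<and> (\<forall>C\<in>I. \<exists>!D. D \<in> J \<and> \<Inter>Q \<inter> D = \<Inter>Q \<inter> C)"

definition tree_equations :: "('v, 'e::finite) multigraph \<Rightarrow> (real ^ 'e) set set" where
  "tree_equations G = {{x. esum x (edges G) = real (card (verts G)) - 1}}"

definition tree_inequalities :: "('v, 'e::finite) multigraph \<Rightarrow> (real ^ 'e) set set" where
  "tree_inequalities G =
     {{x. esum x P \<le> 1} | P. essential_parallel_closure (graphical_matroid G) P} \<union>
     {{x. esum x S \<ge> real (card S) - 1} | S.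
        essential_coparallel_closure (graphical_matroid G) S} \<union>
     {{x. esum x (edges H) \<le> real (card (verts H)) - 1} | H. locked_subgraph H G}"

text \<open>If \<open>P\<close> is an essential parallel closure and its complement \<open>S\<close> is an essential coparallel
  closure, then \<open>card S = n - 1\<close>, and on the hyperplane x(E(G)) = n - 1 the constraints
  \<open>x(P) \<le> 1\<close> and \<open>x(S) \<ge> card S - 1\<close> say the same. This happens exactly when
  \<open>G\<close> is a cycle of length at least 3 with one edge replaced by two or more parallel edges,
  such as a triangle with one doubled edge.\<close>

definition complementary_closures :: "('v, 'e) multigraph \<Rightarrow> bool" where
  "complementary_closures G \<longleftrightarrow>
     (\<exists>P. essential_parallel_closure (graphical_matroid G) P \<and>
          essential_coparallel_closure (graphical_matroid G) (edges G - P))"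

text \<open>Two vertices joined by exactly two edges. The graphical matroid is 2-connected and the
  polytope is the segment from (0,1) to (1,0), but the only parallel and the only coparallel
  closure is the whole edge set and there is no locked subset, so that the constraints do not
  give \<open>x \<ge> 0\<close>.\<close>

definition digon :: "('v, 'e) multigraph \<Rightarrow> bool" where
  "digon G \<longleftrightarrow> card (verts G) = 2 \<and> card (edges G) = 2"

end

theory Submission
  imports Defs
begin

text \<open>
  For a 2-connected matroid \<open>M\<close>, call \<open>L\<close> a flacet if both \<open>M|L\<close> and \<open>M/L\<close> are 2-connected. Modulo the
  equation \<open>x(E) = r(E)\<close> the listed constraints are exactly the inequalities \<open>x(L) \<le> r(L)\<close> of the
  flacets: rank 1 gives the essential parallel closures, corank 1 of the complement gives the
  essential coparallel closures, and the remaining flacets are the locked subsets.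

  By the greedy algorithm all inequalities \<open>x(F) \<le> r(F)\<close> together describe the base polytope. They follow
  from those of the flacets, because \<open>r(F) - x(F)\<close> is submodular: it is additive over a separation
  of \<open>M|F\<close> or of \<open>M/F\<close>, so one of the two parts of a violated set is again violated.
  No flacet inequality is redundant: if every basis tight for the flacet \<open>L\<close> were tight for \<open>L'\<close>, then
  \<open>L'\<close> would be a separator of the direct sum of \<open>M|L\<close> and \<open>M/L\<close>, hence \<open>L' = L\<close> or \<open>L' = E - L\<close>, and
  the latter would disconnect \<open>M\<close>. So the barycentre of the bases tight for \<open>L\<close> can be moved across the
  hyperplane of \<open>L\<close> alone.
\<close>

lemma ground_dual [simp]: "ground (dual M) = ground M"
  by (simp add: dual_def)

lemma ground_restriction [simp]: "ground (restriction N X) = X"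
  by (simp add: restriction_def)

lemma dual_basis_iff: "C \<in> bases (dual M) \<longleftrightarrow> (\<exists>B\<in>bases M. C = ground M - B)"
  by (auto simp: dual_def)

lemma bases_restriction:
  "C \<in> bases (restriction M X) \<longleftrightarrow> (\<exists>B\<in>bases M. C = B \<inter> X \<and> card (B \<inter> X) = mrank M X)"
  by (auto simp: restriction_def)

section \<open>Matroids with the greedy property\<close>

text \<open>Gale's characterisation of matroids. Stated for chains, it is inherited by duals (complement
  the chain) and by restrictions (add the set one restricts to).\<close>

locale greedy_matroid =
  fixes M :: "'e matroid"
  assumes finite_ground: "finite (ground M)"
    and basis_subset: "B \<in> bases M \<Longrightarrow> B \<subseteq> ground M"
    and card_basis: "B \<in> bases M \<Longrightarrow> card B = mrank M (ground M)"
    and greedy: "finite \<C> \<Longrightarrow> \<C> \<subseteq> Pow (ground M) \<Longrightarrow> chain_subset \<C> \<Longrightarrow>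
      \<exists>B\<in>bases M. \<forall>X\<in>\<C>. card (B \<inter> X) = mrank M X"
begin

lemma bases_nonempty: "bases M \<noteq> {}"
  using greedy[of "{}"] by (auto simp: chain_subset_def)

lemma finite_bases: "finite (bases M)"
  by (rule finite_subset[of _ "Pow (ground M)"]) (use basis_subset finite_ground in auto)

lemma finite_basis: "B \<in> bases M \<Longrightarrow> finite B"
  using basis_subset finite_ground finite_subset by blast

lemma card_basis_Int_le: "B \<in> bases M \<Longrightarrow> card (B \<inter> X) \<le> mrank M X"
  unfolding mrank_def by (rule Max_ge) (use finite_bases in auto)

lemma card_basis_Int_Diff:
  assumes "B \<in> bases M" "X \<subseteq> ground M"
  shows "card (B \<inter> X) + card (B \<inter> (ground M - X)) = mrank M (ground M)"
proof -
  have "card (B \<inter> X) + card (B \<inter> (ground M - X)) = card ((B \<inter> X) \<union> (B \<inter> (ground M - X)))"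
    by (rule card_Un_disjoint[symmetric]) (use finite_basis assms in auto)
  also have "(B \<inter> X) \<union> (B \<inter> (ground M - X)) = B"
    using assms basis_subset by blast
  finally show ?thesis
    using card_basis assms by simp
qed

lemma greedy2:
  assumes "X \<subseteq> Y" "Y \<subseteq> ground M"
  obtains B where "B \<in> bases M" "card (B \<inter> X) = mrank M X" "card (B \<inter> Y) = mrank M Y"
  using greedy[of "{X, Y}"] assms by (auto simp: chain_subset_def)

lemma greedy3:
  assumes "X \<subseteq> Y" "Y \<subseteq> Z" "Z \<subseteq> ground M"
  obtains B where "B \<in> bases M" "card (B \<inter> X) = mrank M X" "card (B \<inter> Y) = mrank M Y"
    "card (B \<inter> Z) = mrank M Z"
  using greedy[of "{X, Y, Z}"] assms by (auto simp: chain_subset_def)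

lemma rank_empty [simp]: "mrank M {} = 0"
  by (rule greedy2[of "{}" "{}"]) auto

lemma rank_mono: "X \<subseteq> Y \<Longrightarrow> Y \<subseteq> ground M \<Longrightarrow> mrank M X \<le> mrank M Y"
proof -
  assume X: "X \<subseteq> Y" "Y \<subseteq> ground M"
  obtain B where B: "B \<in> bases M" "card (B \<inter> X) = mrank M X" "card (B \<inter> Y) = mrank M Y"
    using greedy2[OF X] .
  have "card (B \<inter> X) \<le> card (B \<inter> Y)"
    by (rule card_mono) (use X B finite_basis in auto)
  then show ?thesis using B by simp
qed

lemma card_Int_Un:
  assumes "finite B"
  shows "card (B \<inter> (X \<inter> Y)) + card (B \<inter> (X \<union> Y)) = card (B \<inter> X) + card (B \<inter> Y)"
  using card_Un_Int[of "B \<inter> X" "B \<inter> Y"] assms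
  by (simp add: Int_Un_distrib Int_ac)

text \<open>One basis attains the ranks of both members of the chain \<open>X \<inter> Y\<close>,
  \<open>X \<union> Y\<close>. Counting its elements is modular, and its traces on \<open>X\<close>
  and \<open>Y\<close> are bounded by their ranks.\<close>

lemma rank_submodular:
  assumes "X \<subseteq> ground M" "Y \<subseteq> ground M"
  shows "mrank M (X \<inter> Y) + mrank M (X \<union> Y) \<le> mrank M X + mrank M Y"
proof -
  obtain B where B: "B \<in> bases M" "card (B \<inter> (X \<inter> Y)) = mrank M (X \<inter> Y)"
    "card (B \<inter> (X \<union> Y)) = mrank M (X \<union> Y)"
    using greedy2[of "X \<inter> Y" "X \<union> Y"] assms by blast
  then show ?thesis
    using card_Int_Un[OF finite_basis[OF B(1)], of X Y] card_basis_Int_le[OF B(1), of X]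
      card_basis_Int_le[OF B(1), of Y] by linarith
qed

lemma rank_submodularI:
  assumes "X \<subseteq> ground M" "Y \<subseteq> ground M" "X \<inter> Y = I" "X \<union> Y = U"
  shows "mrank M I + mrank M U \<le> mrank M X + mrank M Y"
  using rank_submodular[OF assms(1,2)] assms(3,4) by simp

lemma rank_le_card: "X \<subseteq> ground M \<Longrightarrow> mrank M X \<le> card X"
proof -
  assume X: "X \<subseteq> ground M"
  obtain B where B: "B \<in> bases M" "card (B \<inter> X) = mrank M X"
    using greedy2[of X X] X by blast
  have "card (B \<inter> X) \<le> card X"
    by (rule card_mono) (use X finite_ground finite_subset in auto)
  then show ?thesis using B by simp
qed

section \<open>Duals and restrictions\<close>

lemma card_dual_basis_Int:
  assumes "B \<in> bases M" "X \<subseteq> ground M"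
  shows "card ((ground M - B) \<inter> X) + mrank M (ground M) = card X + card (B \<inter> (ground M - X))"
proof -
  have "finite X" using assms finite_ground finite_subset by blast
  then have "card ((ground M - B) \<inter> X) + card (B \<inter> X) = card X"
    using assms by (subst card_Un_disjoint[symmetric]) (auto intro!: arg_cong[of _ _ card])
  then show ?thesis using card_basis_Int_Diff[OF assms] by linarith
qed

lemma finite_dual_bases: "finite (bases (dual M))"
  using finite_bases by (simp add: dual_def Setcompr_eq_image)

text \<open>The cobasis meeting \<open>X\<close> most is the complement of a basis meeting the rest
  of the ground set most. The additive form avoids subtraction of naturals.\<close>

lemma rank_dual:
  assumes "X \<subseteq> ground M"
  shows "mrank (dual M) X + mrank M (ground M) = card X + mrank M (ground M - X)"
proof -
  obtain B where B: "B \<in> bases M" "card (B \<inter> (ground M - X)) = mrank M (ground M - X)"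
    using greedy2[of "ground M - X" "ground M - X"] by blast
  have "mrank (dual M) X = card ((ground M - B) \<inter> X)"
    unfolding mrank_def
  proof (rule Max_eqI)
    show "finite ((\<lambda>C. card (C \<inter> X)) ` bases (dual M))"
      using finite_dual_bases by simp
    show "card ((ground M - B) \<inter> X) \<in> (\<lambda>C. card (C \<inter> X)) ` bases (dual M)"
      using B(1) by (intro image_eqI[of _ _ "ground M - B"]) (auto simp: dual_basis_iff)
    fix y assume "y \<in> (\<lambda>C. card (C \<inter> X)) ` bases (dual M)"
    then obtain A where A: "A \<in> bases M" "y = card ((ground M - A) \<inter> X)"
      by (auto simp: dual_basis_iff)
    show "y \<le> card ((ground M - B) \<inter> X)"
      using card_dual_basis_Int[OF A(1) assms] card_dual_basis_Int[OF B(1) assms]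
        card_basis_Int_le[OF A(1), of "ground M - X"] A(2) B(2) by linarith
  qed
  then show ?thesis using card_dual_basis_Int[OF B(1) assms] B(2) by simp
qed

lemma greedy_matroid_dual: "greedy_matroid (dual M)"
proof
  show "finite (ground (dual M))" by (simp add: finite_ground)
  show "B \<subseteq> ground (dual M)" if "B \<in> bases (dual M)" for B
    using that by (auto simp: dual_basis_iff)
  show "card B = mrank (dual M) (ground (dual M))" if B: "B \<in> bases (dual M)" for B
  proof -
    obtain A where A: "A \<in> bases M" "B = ground M - A" using B by (auto simp: dual_basis_iff)
    have "(ground M - A) \<inter> ground M = B" using A by auto
    then show ?thesis
      using card_dual_basis_Int[OF A(1) subset_refl] rank_dual[OF subset_refl] by simp
  qed
  fix \<C> assume C: "finite \<C>" "\<C> \<subseteq> Pow (ground (dual M))" "chain_subset \<C>"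
  have "chain_subset ((\<lambda>X. ground M - X) ` \<C>)"
    using C(3) by (fastforce simp: chain_subset_def)
  then obtain A where A: "A \<in> bases M"
    "\<And>X. X \<in> \<C> \<Longrightarrow> card (A \<inter> (ground M - X)) = mrank M (ground M - X)"
    using greedy[of "(\<lambda>X. ground M - X) ` \<C>"] C(1) by auto
  have "card ((ground M - A) \<inter> X) = mrank (dual M) X" if "X \<in> \<C>" for X
  proof -
    have "X \<subseteq> ground M" using that C(2) by auto
    then show ?thesis
      using card_dual_basis_Int[OF A(1), of X] rank_dual[of X] A(2)[OF that] by linarith
  qed
  then show "\<exists>B\<in>bases (dual M). \<forall>X\<in>\<C>. card (B \<inter> X) = mrank (dual M) X"
    using A(1) by (intro bexI[of _ "ground M - A"]) (auto simp: dual_basis_iff)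
qed



text \<open>The trace on \<open>X\<close> of a basis that is greedy for \<open>Y\<close> and
  \<open>X\<close> at once is a basis of the restriction.\<close>

lemma rank_restriction:
  assumes "Y \<subseteq> X" "X \<subseteq> ground M"
  shows "mrank (restriction M X) Y = mrank M Y"
proof -
  obtain B where B: "B \<in> bases M" "card (B \<inter> Y) = mrank M Y" "card (B \<inter> X) = mrank M X"
    using greedy2[OF assms] .
  show ?thesis
    unfolding mrank_def[of "restriction M X"]
  proof (rule Max_eqI)
    show "finite ((\<lambda>C. card (C \<inter> Y)) ` bases (restriction M X))"
      using finite_bases by (simp add: restriction_def Setcompr_eq_image)
    have "B \<inter> X \<inter> Y = B \<inter> Y" using assms by auto
    then show "mrank M Y \<in> (\<lambda>C. card (C \<inter> Y)) ` bases (restriction M X)"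
      using B by (intro image_eqI[of _ _ "B \<inter> X"]) (auto simp: bases_restriction)
    fix y assume "y \<in> (\<lambda>C. card (C \<inter> Y)) ` bases (restriction M X)"
    then obtain A where A: "A \<in> bases M" "y = card (A \<inter> X \<inter> Y)"
      by (auto simp: bases_restriction)
    have "A \<inter> X \<inter> Y = A \<inter> Y" using assms by auto
    then show "y \<le> mrank M Y" using A card_basis_Int_le by metis
  qed
qed

lemma greedy_matroid_restriction:
  assumes X: "X \<subseteq> ground M"
  shows "greedy_matroid (restriction M X)"
proof
  show "finite (ground (restriction M X))" using X finite_ground finite_subset by auto
  show "B \<subseteq> ground (restriction M X)" if "B \<in> bases (restriction M X)" for B
    using that by (auto simp: bases_restriction)
  show "card B = mrank (restriction M X) (ground (restriction M X))"
    if "B \<in> bases (restriction M X)" for B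
    using that X by (auto simp: bases_restriction rank_restriction)
  fix \<C> assume C: "finite \<C>" "\<C> \<subseteq> Pow (ground (restriction M X))" "chain_subset \<C>"
  have "chain_subset (insert X \<C>)"
    using C by (auto simp: chain_subset_def)
  moreover have "insert X \<C> \<subseteq> Pow (ground M)" using C X by auto
  ultimately obtain A where A: "A \<in> bases M" "card (A \<inter> X) = mrank M X"
    "\<And>Y. Y \<in> \<C> \<Longrightarrow> card (A \<inter> Y) = mrank M Y"
    using greedy[of "insert X \<C>"] C(1) by auto
  have "card (A \<inter> X \<inter> Y) = mrank (restriction M X) Y" if "Y \<in> \<C>" for Y
  proof -
    have "Y \<subseteq> X" using that C(2) by auto
    then have "A \<inter> X \<inter> Y = A \<inter> Y" by auto
    then show ?thesis using A(3)[OF that] rank_restriction[OF \<open>Y \<subseteq> X\<close> X] by simp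
  qed
  then show "\<exists>B\<in>bases (restriction M X). \<forall>Y\<in>\<C>. card (B \<inter> Y) = mrank (restriction M X) Y"
    using A(1,2) by (intro bexI[of _ "A \<inter> X"]) (auto simp: bases_restriction)
qed

section \<open>2-connectedness of duals and minors\<close>

lemma two_connected_dual_iff: "two_connected (dual M) \<longleftrightarrow> two_connected M"
proof -
  \<comment> \<open>The connectivity function r(X) + r(E - X) - r(E) is self-dual: in
    \<open>rank_dual\<close> the cardinalities of \<open>X\<close> and its complement add up to that
    of the ground set.\<close>
  have "mrank (dual M) (ground M) = mrank (dual M) X + mrank (dual M) (ground M - X) \<longleftrightarrow>
      mrank M (ground M) = mrank M X + mrank M (ground M - X)" if X: "X \<subseteq> ground M" for X
  proof -
    have "card X + card (ground M - X) = card (ground M)"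
      using X finite_ground by (metis card_Diff_subset card_mono finite_subset le_add_diff_inverse)
    moreover have "ground M - (ground M - X) = X" using X by auto
    ultimately show ?thesis
      using rank_dual[OF X] rank_dual[of "ground M - X"] rank_dual[OF subset_refl]
      by (simp; arith)
  qed
  then show ?thesis
    unfolding two_connected_def disconnected_def by (metis ground_dual psubset_imp_subset)
qed

end

lemma two_connected_contraction_iff:
  assumes "greedy_matroid M"
  shows "two_connected (contraction M L) \<longleftrightarrow> two_connected (restriction (dual M) (ground M - L))"
proof -
  interpret M: greedy_matroid M by fact
  interpret D: greedy_matroid "dual M" by (rule M.greedy_matroid_dual)
  interpret R: greedy_matroid "restriction (dual M) (ground M - L)"
    by (rule D.greedy_matroid_restriction) auto
  show ?thesis
    unfolding contraction_def deletion_def using R.two_connected_dual_iff by simp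
qed

context greedy_matroid
begin

lemma connected_restriction_iff:
  assumes "L \<subseteq> ground M"
  shows "two_connected (restriction M L) \<longleftrightarrow>
    L \<noteq> {} \<and> (\<forall>X. X \<noteq> {} \<and> X \<subset> L \<longrightarrow> mrank M L \<noteq> mrank M X + mrank M (L - X))"
  unfolding two_connected_def disconnected_def
  using assms by (auto simp: rank_restriction psubset_imp_subset)

text \<open>The rank of \<open>X\<close> in M/L is r(L \<union> X) - r(L). The other side of a
  separation of M/L is \<open>ground M - L - X\<close>, which together with \<open>L\<close> is
  \<open>ground M - X\<close>; hence the equation.\<close>

lemma connected_dual_restriction_iff:
  assumes L: "L \<subseteq> ground M"
  shows "two_connected (restriction (dual M) (ground M - L)) \<longleftrightarrow>
    L \<noteq> ground M \<and> (\<forall>X. X \<noteq> {} \<and> X \<subset> ground M - L \<longrightarrow>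
      mrank M (ground M) + mrank M L \<noteq> mrank M (L \<union> X) + mrank M (ground M - X))"
proof -
  interpret D: greedy_matroid "dual M" by (rule greedy_matroid_dual)
  have "mrank (dual M) (ground M - L) = mrank (dual M) X + mrank (dual M) (ground M - L - X) \<longleftrightarrow>
     mrank M (ground M) + mrank M L = mrank M (L \<union> X) + mrank M (ground M - X)"
    if X: "X \<subseteq> ground M - L" for X
  proof -
    have "X \<subseteq> ground M" "ground M - L - X \<subseteq> ground M" using X by auto
    note X_ground = this
    have "card X + card (ground M - L - X) = card (ground M - L)"
      using X finite_ground by (metis card_Diff_subset card_mono finite_Diff finite_subset le_add_diff_inverse)
    moreover have "ground M - (ground M - L) = L" "ground M - (ground M - L - X) = L \<union> X"
      using X L by auto
    ultimately show ?thesis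
      using rank_dual[of X] rank_dual[of "ground M - L - X"] rank_dual[of "ground M - L"] X
      by (simp add: X_ground Diff_subset; arith)
  qed
  moreover have "ground M - L = {} \<longleftrightarrow> L = ground M" using L by auto
  moreover have "two_connected (restriction (dual M) (ground M - L)) \<longleftrightarrow>
    ground M - L \<noteq> {} \<and> (\<forall>X. X \<noteq> {} \<and> X \<subset> ground M - L \<longrightarrow>
      mrank (dual M) (ground M - L) \<noteq> mrank (dual M) X + mrank (dual M) (ground M - L - X))"
    by (rule D.connected_restriction_iff) auto
  ultimately show ?thesis
    by (metis psubset_imp_subset)
qed

end

section \<open>Flacets\<close>

text \<open>\<open>M*|(E - L)\<close> is the dual of \<open>M/L\<close>, so its 2-connectedness is that of \<open>M/L\<close>.\<close>

definition flacet :: "'e matroid \<Rightarrow> 'e set \<Rightarrow> bool" where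
  "flacet M L \<longleftrightarrow> L \<subseteq> ground M \<and> two_connected (restriction M L) \<and>
     two_connected (restriction (dual M) (ground M - L))"

context greedy_matroid
begin

lemma flacetD:
  assumes "flacet M L"
  shows "L \<subseteq> ground M" "L \<noteq> {}" "L \<noteq> ground M"
    and "\<And>X. X \<noteq> {} \<Longrightarrow> X \<subset> L \<Longrightarrow> mrank M L \<noteq> mrank M X + mrank M (L - X)"
    and "\<And>X. X \<noteq> {} \<Longrightarrow> X \<subset> ground M - L \<Longrightarrow>
      mrank M (ground M) + mrank M L \<noteq> mrank M (L \<union> X) + mrank M (ground M - X)"
  using assms connected_restriction_iff[of L] connected_dual_restriction_iff[of L]
  unfolding flacet_def by blast+

lemma connectedD:
  "two_connected M \<Longrightarrow> X \<noteq> {} \<Longrightarrow> X \<subset> ground M \<Longrightarrow>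
    mrank M (ground M) \<noteq> mrank M X + mrank M (ground M - X)"
  by (auto simp: two_connected_def disconnected_def)

text \<open>A separation passes to subsets: adding submodularity for \<open>F\<close>,
  \<open>X\<close> and for \<open>F \<union> X\<close>, \<open>G - X\<close> cancels the terms of
  \<open>G\<close>, and subadditivity gives the other inequality.\<close>

lemma rank_separation_Int:
  assumes "mrank M G = mrank M X + mrank M (G - X)" "F \<subseteq> G" "X \<subseteq> G" "G \<subseteq> ground M"
  shows "mrank M F = mrank M (F \<inter> X) + mrank M (F - X)"
proof -
  have 1: "mrank M (F \<inter> X) + mrank M (F \<union> X) \<le> mrank M F + mrank M X"
    by (rule rank_submodular) (use assms in auto)
  have 2: "mrank M (F - X) + mrank M G \<le> mrank M (F \<union> X) + mrank M (G - X)"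
    by (rule rank_submodularI) (use assms in auto)
  have 3: "mrank M {} + mrank M F \<le> mrank M (F \<inter> X) + mrank M (F - X)"
    by (rule rank_submodularI) (use assms in auto)
  show ?thesis using 1 2 3 assms(1) by simp
qed

text \<open>\<open>A\<close> is one side of a separation of M/F. A separation of the restriction to
  \<open>F \<union> A\<close> cannot cut the connected \<open>F\<close>, so one of its sides lies in
  \<open>A\<close>, and that side would separate \<open>M\<close> itself.\<close>

lemma connected_Un_of_separation:
  assumes M: "two_connected M" and F: "F \<subseteq> ground M" "two_connected (restriction M F)"
    and A: "A \<subseteq> ground M - F"
    and sep: "mrank M (ground M) + mrank M F = mrank M (F \<union> A) + mrank M (ground M - A)"
  shows "two_connected (restriction M (F \<union> A))"
proof -
  have FA: "F \<union> A \<subseteq> ground M" using F A by auto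
  have F': "F \<noteq> {}" "\<And>X. X \<noteq> {} \<Longrightarrow> X \<subset> F \<Longrightarrow> mrank M F \<noteq> mrank M X + mrank M (F - X)"
    using F connected_restriction_iff by blast+
  \<comment> \<open>\<open>F \<union> A - Y\<close> and \<open>ground M - A\<close> meet in
    \<open>F\<close> and have union \<open>ground M - Y\<close>; given both separations,
    submodularity makes \<open>Y\<close> a separator of \<open>M\<close>.\<close>
  have no_sep: False
    if Y: "Y \<noteq> {}" "Y \<subseteq> A" and r: "mrank M (F \<union> A) = mrank M (F \<union> A - Y) + mrank M Y" for Y
  proof -
    have "mrank M F + mrank M (ground M - Y) \<le> mrank M (F \<union> A - Y) + mrank M (ground M - A)"
      by (rule rank_submodularI) (use F A Y in auto)
    moreover have "mrank M {} + mrank M (ground M) \<le> mrank M Y + mrank M (ground M - Y)"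
      by (rule rank_submodularI) (use A Y in auto)
    moreover have "Y \<subset> ground M" using Y A F'(1) F(1) by blast
    then have "mrank M (ground M) \<noteq> mrank M Y + mrank M (ground M - Y)"
      by (rule connectedD[OF M Y(1)])
    ultimately show False using r sep by simp
  qed
  have "mrank M (F \<union> A) \<noteq> mrank M X + mrank M (F \<union> A - X)"
    if X: "X \<noteq> {}" "X \<subset> F \<union> A" for X
  proof
    assume r: "mrank M (F \<union> A) = mrank M X + mrank M (F \<union> A - X)"
    have "mrank M F = mrank M (F \<inter> X) + mrank M (F - X)"
      by (rule rank_separation_Int[OF r]) (use X FA in auto)
    moreover have "F - (F \<inter> X) = F - X" by auto
    ultimately have "F \<inter> X = {} \<or> F \<inter> X = F"
      using F'(2)[of "F \<inter> X"] by auto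
    then show False
    proof
      assume "F \<inter> X = {}"
      then show False using no_sep[of X] X r by auto
    next
      assume *: "F \<inter> X = F"
      then have "F \<union> A - (F \<union> A - X) = X" using X by auto
      then show False using no_sep[of "F \<union> A - X"] X r * by auto
    qed
  qed
  then show ?thesis using connected_restriction_iff[OF FA] F' by auto
qed

text \<open>A violated set contains a violated connected one, and a maximal violated connected set is a
  flacet: the two sides of a separation of the contraction would give larger ones.\<close>

lemma rank_inequalities_of_flacets:
  fixes x :: "'e \<Rightarrow> real"
  assumes M: "two_connected M"
    and total: "sum x (ground M) = mrank M (ground M)"
    and flacets: "\<And>L. flacet M L \<Longrightarrow> sum x L \<le> mrank M L"
    and F: "F \<subseteq> ground M"
  shows "sum x F \<le> mrank M F"
proof (rule ccontr)
  define viol where "viol F \<longleftrightarrow> F \<subseteq> ground M \<and> mrank M F < sum x F" for F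
  assume "\<not> sum x F \<le> mrank M F"
  then have "viol F" using F by (simp add: viol_def)
  have split: "sum x F = sum x X + sum x (F - X)" if "X \<subseteq> F" "F \<subseteq> ground M" for X F
    using that finite_ground finite_subset sum.subset_diff[of X F x] by (metis add.commute)
  have conn: "\<exists>K. viol K \<and> two_connected (restriction M K)" if "viol F" for F
    using that
  proof (induction "card F" arbitrary: F rule: less_induct)
    case less
    have F: "F \<subseteq> ground M" "finite F" and F0: "F \<noteq> {}"
      using less.prems finite_ground finite_subset by (auto simp: viol_def)
    show ?case
    proof (cases "two_connected (restriction M F)")
      case False
      then obtain X where X: "X \<noteq> {}" "X \<subset> F" "mrank M F = mrank M X + mrank M (F - X)"
        using connected_restriction_iff[OF F(1)] F0 by blast
      have "viol X \<or> viol (F - X)"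
        using less.prems split[of X F] X F by (auto simp: viol_def)
      moreover have "card X < card F" "card (F - X) < card F"
        using X F by (auto intro!: psubset_card_mono)
      ultimately show ?thesis using less.hyps by blast
    qed (use less.prems in blast)
  qed
  define \<S> where "\<S> = {K. viol K \<and> two_connected (restriction M K)}"
  have "finite \<S>"
    by (rule finite_subset[of _ "Pow (ground M)"]) (auto simp: \<S>_def viol_def finite_ground)
  moreover have "\<S> \<noteq> {}" using conn[OF \<open>viol F\<close>] by (auto simp: \<S>_def)
  ultimately obtain K where K: "K \<in> \<S>" "\<And>K'. K' \<in> \<S> \<Longrightarrow> K \<subseteq> K' \<Longrightarrow> K = K'"
    using finite_has_maximal[of \<S>] by auto
  have K1: "K \<subseteq> ground M" "mrank M K < sum x K" "two_connected (restriction M K)"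
    using K by (auto simp: \<S>_def viol_def)
  have "\<not> flacet M K" using flacets[of K] K1 by auto
  moreover have "K \<noteq> ground M" using K1 total by auto
  ultimately obtain A where A: "A \<noteq> {}" "A \<subset> ground M - K"
    and sep: "mrank M (ground M) + mrank M K = mrank M (K \<union> A) + mrank M (ground M - A)"
    using connected_dual_restriction_iff[OF K1(1)] K1 by (auto simp: flacet_def)
  let ?B = "ground M - K - A"
  have B: "K \<union> ?B = ground M - A" "ground M - ?B = K \<union> A" using A K1 by auto
  have "two_connected (restriction M (K \<union> A))"
    by (rule connected_Un_of_separation[OF M K1(1,3) _ sep]) (use A in auto)
  moreover have "two_connected (restriction M (K \<union> ?B))"
    by (rule connected_Un_of_separation[OF M K1(1,3)]) (use sep B in auto)
  moreover have "K \<union> A \<noteq> K" "K \<union> ?B \<noteq> K" using A by auto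
  ultimately have "\<not> viol (K \<union> A)" "\<not> viol (K \<union> ?B)"
    using K(2) unfolding \<S>_def by blast+
  \<comment> \<open>By \<open>sep\<close> the right sides add up to r(E) + r(K), while the left
    sides add up to x(E) + x(K). As x(E) = r(E), the set \<open>K\<close> would not be
    violated.\<close>
  then have "sum x (K \<union> A) \<le> mrank M (K \<union> A)" "sum x (ground M - A) \<le> mrank M (ground M - A)"
    using B A K1 by (auto simp: viol_def)
  moreover have "ground M - A - K = ?B" "ground M - (K \<union> A) = ?B" "K \<subseteq> ground M - A" "K \<union> A \<subseteq> ground M"
    using A K1(1) by auto
  then have "sum x (ground M - A) = sum x K + sum x ?B" "sum x (K \<union> A) + sum x ?B = sum x (ground M)"
    using split[of K "ground M - A"] split[of "K \<union> A" "ground M"] by auto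
  moreover have "K \<union> A - K = A" "K \<union> A \<subseteq> ground M" using A K1(1) by auto
  then have "sum x K + sum x A = sum x (K \<union> A)"
    using split[of K "K \<union> A"] by auto
  ultimately show False using K1(2) total sep by linarith
qed

section \<open>Bases that distinguish flacets\<close>

lemma ex_basis_tight_not_tight:
  assumes M: "two_connected M" and L: "flacet M L" and L': "flacet M L'" and neq: "L \<noteq> L'"
  shows "\<exists>B\<in>bases M. card (B \<inter> L) = mrank M L \<and> card (B \<inter> L') < mrank M L'"
proof (rule ccontr)
  assume neg: "\<not> ?thesis"
  have tight: "card (B \<inter> L') = mrank M L'" if "B \<in> bases M" "card (B \<inter> L) = mrank M L" for B
    using neg that card_basis_Int_le[of B L'] by force
  note sub = flacetD(1)[OF L] flacetD(1)[OF L']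
  let ?E = "ground M"
  \<comment> \<open>Being tight for \<open>L\<close>, the basis \<open>B\<close> is tight for
    \<open>L'\<close> as well, and it attains the rank at both ends of the chain; so the rank is
    modular on the pair \<open>L\<close>, \<open>L'\<close>.\<close>
  obtain B where B: "B \<in> bases M" "card (B \<inter> (L \<inter> L')) = mrank M (L \<inter> L')"
    "card (B \<inter> L) = mrank M L" "card (B \<inter> (L \<union> L')) = mrank M (L \<union> L')"
    by (rule greedy3[of "L \<inter> L'" L "L \<union> L'"]) (use sub in auto)
  have 1: "mrank M (L \<inter> L') + mrank M (L \<union> L') = mrank M L + mrank M L'"
    using card_Int_Un[OF finite_basis[OF B(1)], of L L'] B tight[OF B(1,3)] by simp
  \<comment> \<open>A second chain through \<open>L\<close>, chosen so that the count of
    \<open>C\<close> involves both parts of \<open>L\<close> cut by \<open>L'\<close> and the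
    complement of \<open>L' - L\<close>.\<close>
  obtain C where C: "C \<in> bases M" "card (C \<inter> (L - L')) = mrank M (L - L')"
    "card (C \<inter> L) = mrank M L" "card (C \<inter> (?E - (L' - L))) = mrank M (?E - (L' - L))"
    by (rule greedy3[of "L - L'" L "?E - (L' - L)"]) (use sub in auto)
  have part: "card (C \<inter> X) = card (C \<inter> (X - Y)) + card (C \<inter> (X \<inter> Y))" for X Y
    by (subst card_Un_disjoint[symmetric])
      (use finite_basis[OF C(1)] in \<open>auto intro!: arg_cong[of _ _ card]\<close>)
  have "card (C \<inter> L) = card (C \<inter> (L - L')) + card (C \<inter> (L \<inter> L'))"
    "card (C \<inter> L') = card (C \<inter> (L' - L)) + card (C \<inter> (L \<inter> L'))"
    using part[of L L'] part[of L' L] by (simp_all add: Int_commute)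
  moreover have "card (C \<inter> (L' - L)) + card (C \<inter> (?E - (L' - L))) = mrank M ?E"
    using card_basis_Int_Diff[OF C(1), of "L' - L"] sub by auto
  ultimately have 2: "mrank M L' + mrank M (L - L') + mrank M (?E - (L' - L)) = mrank M L + mrank M ?E"
    using C tight[OF C(1,3)] by linarith
  have 3: "mrank M {} + mrank M L \<le> mrank M (L \<inter> L') + mrank M (L - L')"
    by (rule rank_submodularI) (use sub in auto)
  have 4: "mrank M L + mrank M ?E \<le> mrank M (L \<union> L') + mrank M (?E - (L' - L))"
    by (rule rank_submodularI) (use sub in auto)
  \<comment> \<open>Adding 1 and 2 gives the sum of 3 and 4 with equality, so 3 and 4 are both
    equalities. These are separation equations for \<open>L \<inter> L'\<close> in M|L and for
    \<open>L' - L\<close> in M/L.\<close>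
  have 5: "mrank M L = mrank M (L \<inter> L') + mrank M (L - L')"
    and 6: "mrank M ?E + mrank M L = mrank M (L \<union> (L' - L)) + mrank M (?E - (L' - L))"
    using 1 2 3 4 by simp_all
  have "L - (L \<inter> L') = L - L'" by auto
  then have "L \<inter> L' = {} \<or> L \<subseteq> L'" using flacetD(4)[OF L, of "L \<inter> L'"] 5 by auto
  moreover have "L' \<subseteq> L \<or> ?E - L \<subseteq> L'" using flacetD(5)[OF L, of "L' - L"] 6 sub by auto
  ultimately have "L' = ?E - L"
    using neq flacetD(2,3)[OF L] flacetD(2,3)[OF L'] sub by blast
  then have "mrank M ?E = mrank M L + mrank M (?E - L)" using 1 sub by (simp add: Un_absorb1)
  then show False using connectedD[OF M, of L] flacetD[OF L] by auto
qed

text \<open>If a basis attaining the rank of \<open>ground M - L\<close> were tight for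
  \<open>L\<close>, its cardinality would make \<open>L\<close> a separator of
  \<open>M\<close>.\<close>

lemma ex_basis_not_tight:
  assumes M: "two_connected M" and L: "flacet M L"
  shows "\<exists>B\<in>bases M. card (B \<inter> L) < mrank M L"
proof -
  note sub = flacetD(1)[OF L]
  obtain B where B: "B \<in> bases M" "card (B \<inter> (ground M - L)) = mrank M (ground M - L)"
    using greedy2[of "ground M - L" "ground M - L"] by blast
  have "L \<subset> ground M" using flacetD(1,3)[OF L] by blast
  then have "card (B \<inter> L) \<noteq> mrank M L"
    using card_basis_Int_Diff[OF B(1) sub] B connectedD[OF M flacetD(2)[OF L]] by simp
  then show ?thesis using B card_basis_Int_le[OF B(1), of L] by force
qed

end

section \<open>The base polytope\<close>

text \<open>Abel summation: up to a constant, \<open>c\<close> is a nonnegative combination of the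
  indicators of its superlevel sets, and the constant contributes nothing because \<open>g\<close>
  has sum 0.\<close>

lemma sum_mult_nonpos_of_superlevel:
  fixes c g :: "'a \<Rightarrow> real"
  assumes "finite A" and "\<And>t. (\<Sum>a | a \<in> A \<and> t \<le> c a. g a) \<le> 0" and "sum g A = 0"
  shows "(\<Sum>a\<in>A. c a * g a) \<le> 0"
  using assms(2)
proof (induction "card (c ` A)" arbitrary: c rule: less_induct)
  case less
  show ?case
  proof (cases "\<exists>m. c ` A \<subseteq> {m}")
    case True
    then obtain m where "c ` A \<subseteq> {m}" by auto
    then have "c a = m" if "a \<in> A" for a using that by auto
    then have "(\<Sum>a\<in>A. c a * g a) = m * sum g A"
      by (simp add: sum_distrib_left)
    then show ?thesis using assms(3) by simp
  next
    case False
    define m where "m = Max (c ` A)"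
    define m' where "m' = Max (c ` A - {m})"
    have ne: "c ` A - {m} \<noteq> {}" using False by auto
    have mA: "m \<in> c ` A" unfolding m_def by (rule Max_in) (use assms(1) False in auto)
    have m': "m' \<in> c ` A" "m' \<noteq> m"
      using Max_in[OF _ ne] assms(1) by (auto simp: m'_def)
    have le_m: "c a \<le> m" if "a \<in> A" for a using that assms(1) by (auto simp: m_def)
    have le_m': "c a \<le> m'" if "a \<in> A" "c a \<noteq> m" for a
      unfolding m'_def by (rule Max_ge) (use that assms(1) in auto)
    have "m' < m" using m' le_m by (force simp: less_le)
    \<comment> \<open>Truncation at the second largest value removes one value of \<open>c\<close>
      and changes the sum by m - m' times the sum of \<open>g\<close> over the top level
      set.\<close>
    define c' where "c' a = min (c a) m'" for a
    have "c' ` A \<subset> c ` A"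
    proof
      show "c' ` A \<subseteq> c ` A" using m'(1) by (auto simp: c'_def min_def)
      have "m \<notin> c' ` A" using \<open>m' < m\<close> by (auto simp: c'_def min_def)
      then show "c' ` A \<noteq> c ` A" using mA by auto
    qed
    then have "card (c' ` A) < card (c ` A)" using assms(1) by (simp add: psubset_card_mono)
    moreover have "(\<Sum>a | a \<in> A \<and> t \<le> c' a. g a) \<le> 0" for t
    proof (cases "t \<le> m'")
      case True
      then show ?thesis using less.prems[of t] by (simp add: c'_def)
    qed (simp add: c'_def)
    ultimately have IH: "(\<Sum>a\<in>A. c' a * g a) \<le> 0" by (rule less.hyps)
    have "c a * g a = c' a * g a + (m - m') * (if m \<le> c a then g a else 0)" if "a \<in> A" for a
      using le_m[OF that] le_m'[OF that] \<open>m' < m\<close>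
      by (cases "c a = m") (auto simp: c'_def min_def algebra_simps)
    then have "(\<Sum>a\<in>A. c a * g a) =
        (\<Sum>a\<in>A. c' a * g a) + (m - m') * (\<Sum>a\<in>A. if m \<le> c a then g a else 0)"
      by (simp add: sum.distrib sum_distrib_left)
    also have "(\<Sum>a\<in>A. if m \<le> c a then g a else 0) = (\<Sum>a | a \<in> A \<and> m \<le> c a. g a)"
      using assms(1) by (simp add: sum.inter_filter)
    finally show ?thesis
      using IH less.prems[of m] \<open>m' < m\<close> by (simp add: mult_nonneg_nonpos add_nonpos_nonpos)
  qed
qed

definition charvec :: "'e set \<Rightarrow> real ^ 'e::finite" where
  "charvec B = (\<chi> e. indicat_real B e)"

lemma esum_charvec: "esum (charvec B) F = card (B \<inter> F)"
  by (simp add: esum_def charvec_def indicator_def sum.If_cases Int_commute)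

lemma esum_add: "esum (x + y) F = esum x F + esum y F"
  by (simp add: esum_def sum.distrib)

lemma esum_scaleR: "esum (a *\<^sub>R x) F = a * esum x F"
  by (simp add: esum_def sum_distrib_left)

lemma esum_diff: "esum (x - y) F = esum x F - esum y F"
  by (simp add: esum_def sum_subtractf)

lemma esum_sum: "esum (sum f A) F = (\<Sum>a\<in>A. esum (f a) F)"
  by (simp add: esum_def sum.swap[of _ _ F])

lemma esum_axis: "esum (axis e 1) F = indicat_real F e"
  by (simp add: esum_def axis_def indicator_def)

lemma convex_esum_le: "convex {x. esum x F \<le> b}"
  by (rule convexI) (auto simp: esum_add esum_scaleR intro: convex_bound_le)

lemma esum_Compl: "esum x (- F) = esum x UNIV - esum x F"
  using sum.subset_diff[of F UNIV "\<lambda>e. x $ e"] by (simp add: esum_def Compl_eq_Diff_UNIV)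

definition base_polytope :: "'e matroid \<Rightarrow> (real ^ 'e::finite) set" where
  "base_polytope M = convex hull (charvec ` bases M)"

locale finite_type_matroid = greedy_matroid M for M :: "'e::finite matroid" +
  assumes UNIV: "ground M = UNIV"
begin

lemma base_polytope_le_rank:
  assumes "x \<in> base_polytope M"
  shows "esum x F \<le> mrank M F"
proof -
  have "base_polytope M \<subseteq> {x. esum x F \<le> mrank M F}"
    unfolding base_polytope_def
    by (rule hull_minimal) (auto simp: esum_charvec card_basis_Int_le convex_esum_le)
  then show ?thesis using assms by auto
qed

lemma base_polytope_total:
  assumes "x \<in> base_polytope M"
  shows "esum x UNIV = mrank M UNIV"
proof -
  have "base_polytope M \<subseteq> {x. esum x UNIV = mrank M UNIV}"
    unfolding base_polytope_def
  proof (rule hull_minimal)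
    show "convex {x. esum x UNIV = real (mrank M UNIV)}"
      by (rule convexI) (auto simp: esum_add esum_scaleR algebra_simps simp flip: distrib_right)
  qed (use UNIV card_basis in \<open>auto simp: esum_charvec\<close>)
  then show ?thesis using assms by auto
qed

text \<open>The greedy basis for the weight of a separating hyperplane attains the rank of every
  superlevel set, so that no point obeying the rank inequalities beats it.\<close>

lemma base_polytopeI:
  assumes total: "esum x UNIV = mrank M UNIV"
    and le: "\<And>F. esum x F \<le> mrank M F"
  shows "x \<in> base_polytope M"
proof (rule ccontr)
  assume "x \<notin> base_polytope M"
  moreover have "closed (base_polytope M)"
    unfolding base_polytope_def
    by (intro compact_imp_closed finite_imp_compact_convex_hull finite_imageI finite_bases)
  ultimately obtain a b where ab: "a \<bullet> x < b" "\<And>y. y \<in> base_polytope M \<Longrightarrow> b < a \<bullet> y"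
    using separating_hyperplane_closed_point[of "base_polytope M" x]
    by (auto simp: base_polytope_def)
  \<comment> \<open>The polytope lies on the side where the product with \<open>a\<close> is large,
    so the basis to compare with \<open>x\<close> is one of maximal weight for -a.\<close>
  define c where "c e = - (a $ e)" for e
  define U where "U t = {e. t \<le> c e}" for t
  have "finite (range (U \<circ> c))" by simp
  moreover have chain: "chain_subset (range U)"
    unfolding chain_subset_def U_def by (auto; force)
  ultimately have "\<exists>B\<in>bases M. \<forall>X\<in>range U. card (B \<inter> X) = mrank M X"
    by (intro greedy) (auto simp: UNIV)
  then obtain B where B: "B \<in> bases M" "\<And>t. card (B \<inter> U t) = mrank M (U t)" by auto
  let ?y = "charvec B :: real ^ 'e"
  have y: "?y \<in> base_polytope M"
    unfolding base_polytope_def by (rule hull_inc) (use B in auto)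
  have "(\<Sum>e\<in>UNIV. c e * (x - ?y) $ e) \<le> 0"
  proof (rule sum_mult_nonpos_of_superlevel)
    show "(\<Sum>e | e \<in> UNIV \<and> t \<le> c e. (x - ?y) $ e) \<le> 0" for t
      using le[of "U t"] esum_charvec[of B "U t"] B(2)[of t] esum_diff[of x ?y "U t"]
      by (simp add: esum_def U_def)
    show "sum (($) (x - ?y)) UNIV = 0"
      using base_polytope_total[OF y] total esum_diff[of x ?y UNIV] by (simp add: esum_def)
  qed simp
  also have "(\<Sum>e\<in>UNIV. c e * (x - ?y) $ e) = - (a \<bullet> (x - ?y))"
    by (simp add: inner_vec_def c_def sum_negf)
  finally show False using ab(1) ab(2)[OF y] by (simp add: inner_diff_right)
qed

lemma base_polytope_flacets:
  assumes M: "two_connected M"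
  shows "x \<in> base_polytope M \<longleftrightarrow>
    esum x UNIV = mrank M UNIV \<and> (\<forall>L. flacet M L \<longrightarrow> esum x L \<le> mrank M L)"
proof (intro iffI conjI)
  assume *: "esum x UNIV = mrank M UNIV \<and> (\<forall>L. flacet M L \<longrightarrow> esum x L \<le> mrank M L)"
  show "x \<in> base_polytope M"
  proof (rule base_polytopeI)
    show "esum x F \<le> mrank M F" for F
      using rank_inequalities_of_flacets[OF M, of "($) x" F] * UNIV by (simp add: esum_def)
  qed (use * in auto)
qed (use base_polytope_le_rank base_polytope_total in auto)

section \<open>Points violating a single constraint\<close>

lemma barycenter:
  assumes "\<B> \<subseteq> bases M" "\<B> \<noteq> {}"
  defines "y \<equiv> (1 / card \<B>) *\<^sub>R (\<Sum>B\<in>\<B>. charvec B)"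
  shows "(\<And>B. B \<in> \<B> \<Longrightarrow> card (B \<inter> F) = k) \<Longrightarrow> esum y F = k"
    and "(\<exists>B\<in>\<B>. card (B \<inter> F) < mrank M F) \<Longrightarrow> esum y F + 1 / card \<B> \<le> mrank M F"
proof -
  have fin: "finite \<B>" using assms(1) finite_bases finite_subset by auto
  then have pos: "real (card \<B>) > 0" using assms(2) by (simp add: card_gt_0_iff)
  have y: "esum y F = (\<Sum>B\<in>\<B>. real (card (B \<inter> F))) / card \<B>"
    by (simp add: y_def esum_scaleR esum_sum esum_charvec)
  show "esum y F = k" if "\<And>B. B \<in> \<B> \<Longrightarrow> card (B \<inter> F) = k"
    using that pos assms(2) by (simp add: y)
  show "esum y F + 1 / card \<B> \<le> mrank M F" if "\<exists>B\<in>\<B>. card (B \<inter> F) < mrank M F"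
  proof -
    obtain B where B: "B \<in> \<B>" "card (B \<inter> F) < mrank M F" using \<open>\<exists>B\<in>\<B>. _\<close> by auto
    \<comment> \<open>The basis \<open>B\<close> falls short of the rank by at least 1, since both
      numbers are integers; averaging turns this gap into a slack of
      \<open>1 / card \<B>\<close>.\<close>
    have "(\<Sum>A\<in>\<B>. real (card (A \<inter> F)) + (if A = B then 1 else 0)) \<le> (\<Sum>A\<in>\<B>. real (mrank M F))"
    proof (rule sum_mono)
      fix A assume "A \<in> \<B>"
      then have "card (A \<inter> F) \<le> mrank M F" using assms(1) card_basis_Int_le by auto
      then show "real (card (A \<inter> F)) + (if A = B then 1 else 0) \<le> real (mrank M F)"
        using B(2) by auto
    qed
    then have "(\<Sum>A\<in>\<B>. real (card (A \<inter> F))) + 1 \<le> card \<B> * mrank M F"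
      using B(1) fin by (simp add: sum.distrib)
    then show ?thesis using pos by (simp add: y add_divide_distrib[symmetric] pos_divide_le_eq mult.commute add.commute)
  qed
qed

lemma ex_violating_only:
  assumes M: "two_connected M" and L: "flacet M L"
  shows "\<exists>x. esum x UNIV = mrank M UNIV \<and> esum x L > mrank M L \<and>
    (\<forall>L'. flacet M L' \<and> L' \<noteq> L \<longrightarrow> esum x L' \<le> mrank M L')"
proof -
  define \<B> where "\<B> = {B \<in> bases M. card (B \<inter> L) = mrank M L}"
  define y :: "real ^ 'e" where "y = (1 / card \<B>) *\<^sub>R (\<Sum>B\<in>\<B>. charvec B)"
  have \<B>: "\<B> \<subseteq> bases M" by (auto simp: \<B>_def)
  have ne: "\<B> \<noteq> {}" using greedy2[of L L] flacetD(1)[OF L] by (auto simp: \<B>_def)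
  have fin: "finite \<B>" using \<B> finite_bases finite_subset by auto
  have pos: "1 / real (card \<B>) > 0" using ne fin by (simp add: card_gt_0_iff)
  obtain e f where ef: "e \<in> L" "f \<notin> L" using flacetD(2,3)[OF L] UNIV by auto
  \<comment> \<open>At \<open>y\<close> the flacet \<open>L\<close> is tight and every other flacet
    has slack at least \<open>1 / card \<B>\<close>. Moving exactly this weight from
    \<open>f\<close> outside \<open>L\<close> to \<open>e\<close> inside keeps the total, violates
    \<open>L\<close> and costs no other flacet more than its slack.\<close>
  define x where "x = y + (1 / card \<B>) *\<^sub>R (axis e 1 - axis f 1)"
  have x: "esum x F = esum y F + 1 / card \<B> * (indicat_real F e - indicat_real F f)" for F
    by (simp add: x_def esum_add esum_scaleR esum_diff esum_axis)
  have "esum y UNIV = mrank M UNIV"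
    unfolding y_def by (rule barycenter(1)[OF \<B> ne]) (use \<B> UNIV card_basis in auto)
  then have "esum x UNIV = mrank M UNIV" by (simp add: x)
  moreover have "esum y L = mrank M L"
    unfolding y_def by (rule barycenter(1)[OF \<B> ne]) (auto simp: \<B>_def)
  then have "esum x L > mrank M L" using ef pos by (simp add: x)
  moreover have "esum x L' \<le> mrank M L'" if L': "flacet M L'" "L' \<noteq> L" for L'
  proof -
    have "\<exists>B\<in>\<B>. card (B \<inter> L') < mrank M L'"
      using ex_basis_tight_not_tight[OF M L L'(1)] L'(2) by (auto simp: \<B>_def)
    then have "esum y L' + 1 / card \<B> \<le> mrank M L'"
      unfolding y_def by (rule barycenter(2)[OF \<B> ne])
    moreover have "1 / card \<B> * (indicat_real L' e - indicat_real L' f) \<le> 1 / card \<B>"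
      using pos by (auto simp: indicator_def)
    ultimately show ?thesis by (simp add: x)
  qed
  ultimately show ?thesis by blast
qed

text \<open>Off the hyperplane x(E) = r(E) the two forms of a flacet constraint are not equivalent,
  so the point that shows the equation to be irredundant has to satisfy both.\<close>

lemma ex_violating_total:
  assumes M: "two_connected M"
  shows "\<exists>x. esum x UNIV > mrank M UNIV \<and> (\<forall>L. flacet M L \<longrightarrow> esum x L \<le> mrank M L \<and>
    real (mrank M UNIV) - mrank M L \<le> esum x (- L))"
proof -
  define y :: "real ^ 'e" where "y = (1 / card (bases M)) *\<^sub>R (\<Sum>B\<in>bases M. charvec B)"
  have pos: "1 / real (card (bases M)) > 0"
    using bases_nonempty finite_bases by (simp add: card_gt_0_iff)
  \<comment> \<open>\<open>undefined\<close> stands for an arbitrary element. The barycentre of all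
    bases has slack at least \<open>1 / card (bases M)\<close> at each flacet, so raising one
    coordinate by this amount breaks only the total.\<close>
  define x where "x = y + (1 / card (bases M)) *\<^sub>R axis (undefined :: 'e) 1"
  have x: "esum x F = esum y F + 1 / card (bases M) * indicat_real F undefined" for F
    by (simp add: x_def esum_add esum_scaleR esum_axis)
  have yU: "esum y UNIV = mrank M UNIV"
    unfolding y_def by (rule barycenter(1)[OF subset_refl bases_nonempty]) (use UNIV card_basis in auto)
  have "esum x L \<le> mrank M L \<and> real (mrank M UNIV) - mrank M L \<le> esum x (- L)" if L: "flacet M L" for L
  proof -
    have "esum y L + 1 / card (bases M) \<le> mrank M L"
      unfolding y_def
      by (rule barycenter(2)[OF subset_refl bases_nonempty]) (use ex_basis_not_tight[OF M L] in blast)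
    moreover have "esum y (- L) = mrank M UNIV - esum y L" using yU by (simp add: esum_Compl)
    moreover have "0 \<le> 1 / card (bases M) * indicat_real F undefined"
      "1 / card (bases M) * indicat_real F undefined \<le> 1 / card (bases M)" for F
      using pos by (auto simp: indicator_def)
    ultimately show ?thesis using x[of L] x[of "- L"] pos by (smt (verit))
  qed
  moreover have "esum x UNIV > mrank M UNIV" using yU pos by (simp add: x)
  ultimately show ?thesis by blast
qed

end

section \<open>Rank functions\<close>

text \<open>Matroid rank axioms in a form that is checked by adding one element: the rank grows by
  at most one, and what a set spans is spanned by every larger set. This suits the graph rank, which
  is computed edge by edge.\<close>

locale rank_increments =
  fixes E :: "'e set" and \<rho> :: "'e set \<Rightarrow> nat"
  assumes finite_E: "finite E"
    and empty [simp]: "\<rho> {} = 0"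
    and step: "F \<subseteq> E \<Longrightarrow> e \<in> E \<Longrightarrow> \<rho> (insert e F) = \<rho> F \<or> \<rho> (insert e F) = Suc (\<rho> F)"
    and span: "F \<subseteq> F' \<Longrightarrow> F' \<subseteq> E \<Longrightarrow> e \<in> E \<Longrightarrow> \<rho> (insert e F) = \<rho> F \<Longrightarrow>
      \<rho> (insert e F') = \<rho> F'"
begin

lemma Un_bounds:
  assumes "F \<subseteq> E" "D \<subseteq> E"
  shows "\<rho> F \<le> \<rho> (F \<union> D) \<and> \<rho> (F \<union> D) \<le> \<rho> F + card D"
proof -
  have "finite D" using assms finite_E finite_subset by auto
  then show ?thesis
    using assms(2)
  proof (induction D)
    case (insert e D)
    then show ?case using step[of "F \<union> D" e] assms(1) by auto
  qed simp
qed

lemma mono: "F \<subseteq> F' \<Longrightarrow> F' \<subseteq> E \<Longrightarrow> \<rho> F \<le> \<rho> F'"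
  using Un_bounds[of F F'] by (auto simp: Un_absorb1)

lemma le_card: "F \<subseteq> E \<Longrightarrow> \<rho> F \<le> card F"
  using Un_bounds[of "{}" F] by simp

lemma independent_subset:
  assumes "I \<subseteq> J" "J \<subseteq> E" "\<rho> J = card J"
  shows "\<rho> I = card I"
proof -
  have "finite J" using assms finite_E finite_subset by auto
  then have "card I + card (J - I) = card J"
    using assms by (metis card_Diff_subset card_mono finite_subset le_add_diff_inverse)
  moreover have "\<rho> J \<le> \<rho> I + card (J - I)"
    using Un_bounds[of I "J - I"] assms by (auto simp: Un_absorb1)
  moreover have "\<rho> I \<le> card I" using assms le_card by auto
  ultimately show ?thesis using assms(3) by linarith
qed

lemma saturated:
  assumes "I \<subseteq> F" "F \<subseteq> E" "\<And>e. e \<in> F \<Longrightarrow> \<rho> (insert e I) = \<rho> I"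
  shows "\<rho> F = \<rho> I"
proof -
  have "\<rho> (I \<union> D) = \<rho> I" if "finite D" "D \<subseteq> F" for D
    using that
  proof (induction D)
    case (insert e D)
    then show ?case using span[of I "I \<union> D" e] assms by auto
  qed simp
  from this[of F] show ?thesis
    using assms finite_E finite_subset by (metis Un_absorb1 subset_refl)
qed

text \<open>A maximal independent set between \<open>I\<close> and \<open>F\<close> spans every
  element of \<open>F\<close>, so by \<open>saturated\<close> it has the rank of
  \<open>F\<close>.\<close>

lemma extend_independent:
  assumes "I \<subseteq> F" "F \<subseteq> E" "\<rho> I = card I"
  obtains J where "I \<subseteq> J" "J \<subseteq> F" "\<rho> J = card J" "\<rho> J = \<rho> F"
proof -
  define \<J> where "\<J> = {J. I \<subseteq> J \<and> J \<subseteq> F \<and> \<rho> J = card J}"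
  have finF: "finite F" using assms finite_E finite_subset by auto
  then have "finite \<J>" by (rule finite_subset[rotated, OF finite_Pow_iff[THEN iffD2]]) (auto simp: \<J>_def)
  moreover have "I \<in> \<J>" using assms by (auto simp: \<J>_def)
  ultimately obtain J where J: "J \<in> \<J>" "\<And>J'. J' \<in> \<J> \<Longrightarrow> J \<subseteq> J' \<Longrightarrow> J = J'"
    using finite_has_maximal[of \<J>] by auto
  have J1: "I \<subseteq> J" "J \<subseteq> F" "\<rho> J = card J" using J(1) by (auto simp: \<J>_def)
  have finJ: "finite J" using J1 finF finite_subset by auto
  have "\<rho> (insert e J) = \<rho> J" if e: "e \<in> F" for e
  proof (rule ccontr)
    assume neq: "\<rho> (insert e J) \<noteq> \<rho> J"
    then have "e \<notin> J" by (auto simp: insert_absorb)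
    moreover have "\<rho> (insert e J) = Suc (\<rho> J)" using step[of J e] neq e J1 assms by auto
    ultimately have "insert e J \<in> \<J>" using J1 e finJ by (auto simp: \<J>_def)
    then show False using J(2)[of "insert e J"] \<open>e \<notin> J\<close> by auto
  qed
  then have "\<rho> F = \<rho> J" using saturated[of J F] J1 assms by auto
  then show ?thesis using that J1 by auto
qed

text \<open>The greedy algorithm along the chain: a set that works for the smaller members is
  extended inside the largest member \<open>Y\<close> to an independent set of full rank.\<close>

lemma greedy_independent:
  assumes "finite \<C>" "\<C> \<subseteq> Pow E" "chain_subset \<C>"
  shows "\<exists>J. J \<subseteq> \<Union>\<C> \<and> \<rho> J = card J \<and> (\<forall>X\<in>\<C>. card (J \<inter> X) = \<rho> X)"
  using assms
proof (induction "card \<C>" arbitrary: \<C> rule: less_induct)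
  case less
  show ?case
  proof (cases "\<C> = {}")
    case False
    then obtain Y where Y: "Y \<in> \<C>" "\<And>X. X \<in> \<C> \<Longrightarrow> Y \<subseteq> X \<Longrightarrow> Y = X"
      using finite_has_maximal[of \<C>] less.prems by meson
    have le: "X \<subseteq> Y" if "X \<in> \<C>" for X
      using Y that less.prems(3) by (auto simp: chain_subset_def)
    have "card (\<C> - {Y}) < card \<C>" using Y less.prems by (meson card_Diff1_less)
    moreover have "chain_subset (\<C> - {Y})" using less.prems(3) by (auto simp: chain_subset_def)
    ultimately obtain I where I: "I \<subseteq> \<Union>(\<C> - {Y})" "\<rho> I = card I"
      "\<And>X. X \<in> \<C> - {Y} \<Longrightarrow> card (I \<inter> X) = \<rho> X"
      using less.hyps[of "\<C> - {Y}"] less.prems by (metis Diff_subset finite_Diff subset_trans)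
    have YE: "Y \<subseteq> E" using Y less.prems by auto
    have "I \<subseteq> Y" using I(1) le by auto
    then obtain J where J: "I \<subseteq> J" "J \<subseteq> Y" "\<rho> J = card J" "\<rho> J = \<rho> Y"
      using extend_independent[OF _ YE I(2)] by blast
    have finJ: "finite J" using J YE finite_E finite_subset by (metis subset_trans)
    have "card (J \<inter> X) = \<rho> X" if X: "X \<in> \<C>" for X
    proof (cases "X = Y")
      case True
      then show ?thesis using J by (simp add: Int_absorb2)
    next
      case False
      have XE: "X \<subseteq> E" using X less.prems by auto
      \<comment> \<open>The extension adds nothing inside a smaller \<open>X\<close>: there
        \<open>I\<close> already has full rank, and the independence of \<open>J\<close> forbids
        more.\<close>
      have "card (I \<inter> X) \<le> card (J \<inter> X)"
        by (rule card_mono) (use J finJ in auto)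
      moreover have "\<rho> (J \<inter> X) = card (J \<inter> X)"
        by (rule independent_subset[of _ J]) (use J YE in auto)
      moreover have "\<rho> (J \<inter> X) \<le> \<rho> X" by (rule mono) (use XE in auto)
      ultimately show ?thesis using I(3)[of X] X False by auto
    qed
    then show ?thesis using J Y(1) by (intro exI[of _ J]) auto
  qed (auto intro!: exI[of _ "{}"])
qed

section \<open>The matroid of a rank function\<close>

definition to_matroid :: "'e matroid" where
  "to_matroid = \<lparr>ground = E, bases = {B. B \<subseteq> E \<and> \<rho> B = card B \<and> \<rho> B = \<rho> E}\<rparr>"

lemma ground_to_matroid [simp]: "ground to_matroid = E"
  by (simp add: to_matroid_def)

lemma bases_to_matroid: "B \<in> bases to_matroid \<longleftrightarrow> B \<subseteq> E \<and> \<rho> B = card B \<and> \<rho> B = \<rho> E"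
  by (simp add: to_matroid_def)

lemma card_basis_Int_le_rank:
  assumes "B \<in> bases to_matroid" "X \<subseteq> E"
  shows "card (B \<inter> X) \<le> \<rho> X"
proof -
  have "\<rho> (B \<inter> X) = card (B \<inter> X)"
    by (rule independent_subset[of _ B]) (use assms in \<open>auto simp: bases_to_matroid\<close>)
  then show ?thesis using mono[of "B \<inter> X" X] assms by auto
qed

lemma greedy_basis:
  assumes "finite \<C>" "\<C> \<subseteq> Pow E" "chain_subset \<C>"
  shows "\<exists>B\<in>bases to_matroid. \<forall>X\<in>\<C>. card (B \<inter> X) = \<rho> X"
proof -
  obtain J where J: "J \<subseteq> \<Union>\<C>" "\<rho> J = card J" "\<And>X. X \<in> \<C> \<Longrightarrow> card (J \<inter> X) = \<rho> X"
    using greedy_independent[OF assms] by auto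
  have JE: "J \<subseteq> E" using J assms by auto
  obtain B where B: "J \<subseteq> B" "B \<subseteq> E" "\<rho> B = card B" "\<rho> B = \<rho> E"
    using extend_independent[OF JE subset_refl J(2)] .
  have "B \<in> bases to_matroid" using B by (auto simp: bases_to_matroid)
  moreover have "card (B \<inter> X) = \<rho> X" if "X \<in> \<C>" for X
  proof -
    have "finite B" using B finite_E finite_subset by auto
    then have "card (J \<inter> X) \<le> card (B \<inter> X)" by (intro card_mono) (use B in auto)
    moreover have "X \<subseteq> E" using that assms by auto
    ultimately show ?thesis
      using J(3)[OF that] card_basis_Int_le_rank[OF \<open>B \<in> bases to_matroid\<close>, of X] by linarith
  qed
  ultimately show ?thesis by auto
qed

lemma mrank_to_matroid:
  assumes "X \<subseteq> E"
  shows "mrank to_matroid X = \<rho> X"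
  unfolding mrank_def
proof (rule Max_eqI)
  have "finite (bases to_matroid)"
    by (rule finite_subset[of _ "Pow E"]) (auto simp: bases_to_matroid finite_E)
  then show "finite ((\<lambda>B. card (B \<inter> X)) ` bases to_matroid)" by simp
  show "\<rho> X \<in> (\<lambda>B. card (B \<inter> X)) ` bases to_matroid"
    using greedy_basis[of "{X}"] assms by (force simp: chain_subset_def)
qed (use assms card_basis_Int_le_rank in auto)

lemma greedy_matroid_to_matroid: "greedy_matroid to_matroid"
proof
  show "card B = mrank to_matroid (ground to_matroid)" if "B \<in> bases to_matroid" for B
    using that by (simp add: mrank_to_matroid bases_to_matroid)
  show "\<exists>B\<in>bases to_matroid. \<forall>X\<in>\<C>. card (B \<inter> X) = mrank to_matroid X"
    if "finite \<C>" "\<C> \<subseteq> Pow (ground to_matroid)" "chain_subset \<C>" for \<C>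
  proof -
    have "mrank to_matroid X = \<rho> X" if "X \<in> \<C>" for X
      using that \<open>\<C> \<subseteq> _\<close> by (intro mrank_to_matroid) auto
    then show ?thesis using greedy_basis[of \<C>] that by simp
  qed
qed (auto simp: finite_E bases_to_matroid)

text \<open>Any element outside a maximal independent subset will do. For edge sets it becomes the
  edge that closes a cycle.\<close>

lemma ex_redundant:
  assumes "T \<subseteq> E" "\<rho> T \<noteq> card T"
  obtains e where "e \<in> T" "\<rho> (T - {e}) = \<rho> T"
proof -
  obtain J where J: "J \<subseteq> T" "\<rho> J = card J" "\<rho> J = \<rho> T"
    using extend_independent[of "{}" T] assms by auto
  moreover have "J \<noteq> T" using J assms by auto
  ultimately obtain e where e: "e \<in> T" "e \<notin> J" by auto
  have "\<rho> J \<le> \<rho> (T - {e})" "\<rho> (T - {e}) \<le> \<rho> T"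
    by (rule mono; use J e assms in auto)+
  then show ?thesis using that[OF e(1)] J by simp
qed

end

section \<open>Graphical matroids\<close>

text \<open>The end map is an argument of its own so that the edge set can vary while the vertices
  stay fixed. The relation lives on the whole type; vertices met by no edge of \<open>F\<close> are
  related only to themselves.\<close>

definition reach :: "('e \<Rightarrow> 'v set) \<Rightarrow> 'e set \<Rightarrow> ('v \<times> 'v) set" where
  "reach d F = {(u, v). \<exists>e\<in>F. d e = {u, v}}\<^sup>*"

text \<open>The rank function of the cycle matroid: the number of vertices minus the number of
  components, a component being the reachability class of a vertex.\<close>

definition graph_rank :: "('e \<Rightarrow> 'v set) \<Rightarrow> 'v set \<Rightarrow> 'e set \<Rightarrow> nat" where
  "graph_rank d V F = card V - card ((\<lambda>v. reach d F `` {v}) ` V)"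

lemma reach_refl [simp]: "(u, u) \<in> reach d F"
  by (simp add: reach_def)

lemma reach_trans: "(u, v) \<in> reach d F \<Longrightarrow> (v, w) \<in> reach d F \<Longrightarrow> (u, w) \<in> reach d F"
  by (simp add: reach_def)

lemma reach_sym: "(u, v) \<in> reach d F \<Longrightarrow> (v, u) \<in> reach d F"
  unfolding reach_def
  by (rule symD[OF sym_rtrancl]) (auto simp: sym_def insert_commute)

lemma reach_edge: "e \<in> F \<Longrightarrow> d e = {u, v} \<Longrightarrow> (u, v) \<in> reach d F"
  unfolding reach_def by auto

lemma reach_mono: "F \<subseteq> F' \<Longrightarrow> reach d F \<subseteq> reach d F'"
  unfolding reach_def by (rule rtrancl_mono) auto

lemma reach_induct [consumes 1, case_names refl step]:
  assumes "(u, v) \<in> reach d F" "P u"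
    and "\<And>y z e. (u, y) \<in> reach d F \<Longrightarrow> e \<in> F \<Longrightarrow> d e = {y, z} \<Longrightarrow> P y \<Longrightarrow> P z"
  shows "P v"
  using assms(1) unfolding reach_def
  by (induction rule: rtrancl_induct) (use assms(2,3) in \<open>auto simp: reach_def\<close>)

lemma reach_class_eq_iff: "reach d F `` {u} = reach d F `` {v} \<longleftrightarrow> (u, v) \<in> reach d F"
proof
  assume eq: "reach d F `` {u} = reach d F `` {v}"
  have "v \<in> reach d F `` {u}" unfolding eq by simp
  then show "(u, v) \<in> reach d F" by simp
next
  assume uv: "(u, v) \<in> reach d F"
  show "reach d F `` {u} = reach d F `` {v}"
    using reach_trans[OF uv] reach_trans[OF reach_sym[OF uv]] by auto
qed

lemma reach_insert:
  assumes "d e = {u, v}"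
  shows "(w, z) \<in> reach d (insert e F) \<longleftrightarrow> (w, z) \<in> reach d F \<or>
    (w \<in> reach d F `` {u} \<union> reach d F `` {v} \<and> z \<in> reach d F `` {u} \<union> reach d F `` {v})"
proof
  assume "(w, z) \<in> reach d (insert e F)"
  then show "(w, z) \<in> reach d F \<or>
    (w \<in> reach d F `` {u} \<union> reach d F `` {v} \<and> z \<in> reach d F `` {u} \<union> reach d F `` {v})"
  proof (induction rule: reach_induct)
    case (step y z f)
    show ?case
    proof (cases "f \<in> F")
      case True
      then have "(y, z) \<in> reach d F" using step by (auto intro: reach_edge)
      from reach_trans[OF _ this] show ?thesis using step.IH by auto
    next
      case False
      then have "{y, z} = {u, v}" using step assms by auto
      then have "z = u \<or> z = v" "y = u \<or> y = v" by (auto simp: doubleton_eq_iff)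
      then show ?thesis using step.IH reach_sym[of w u d F] reach_sym[of w v d F] by auto
    qed
  qed simp
next
  let ?R = "reach d (insert e F)"
  have F: "(x, y) \<in> reach d F \<Longrightarrow> (x, y) \<in> ?R" for x y
    using reach_mono[of F "insert e F" d] by auto
  have uv: "(u, v) \<in> ?R" using assms by (auto intro: reach_edge)
  have from_u: "(u, y) \<in> ?R" if "y \<in> reach d F `` {u} \<union> reach d F `` {v}" for y
    using that F reach_trans[OF uv, of y] by auto
  assume "(w, z) \<in> reach d F \<or>
    (w \<in> reach d F `` {u} \<union> reach d F `` {v} \<and> z \<in> reach d F `` {u} \<union> reach d F `` {v})"
  then show "(w, z) \<in> ?R"
  proof
    assume "w \<in> reach d F `` {u} \<union> reach d F `` {v} \<and> z \<in> reach d F `` {u} \<union> reach d F `` {v}"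
    then show ?thesis using reach_trans[OF reach_sym[OF from_u[of w]] from_u[of z]] by blast
  qed (rule F)
qed

lemma reach_insert_redundant:
  assumes "d e = {u, v}" "(u, v) \<in> reach d F"
  shows "reach d (insert e F) = reach d F"
proof -
  have "reach d F `` {u} = reach d F `` {v}" using assms(2) by (simp add: reach_class_eq_iff)
  then have "(w, z) \<in> reach d (insert e F) \<longleftrightarrow> (w, z) \<in> reach d F" for w z
    unfolding reach_insert[where d = d and e = e, OF assms(1)]
    using reach_trans[OF reach_sym[of v w d F], of z] by auto
  then show ?thesis by auto
qed

text \<open>The two different classes of \<open>u\<close> and \<open>v\<close> are replaced by their
  union and all other classes survive, so exactly one class is lost.\<close>

lemma card_classes_insert:
  assumes V: "finite V" "u \<in> V" "v \<in> V" and e: "d e = {u, v}" and new: "(u, v) \<notin> reach d F"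
  shows "Suc (card ((\<lambda>v. reach d (insert e F) `` {v}) ` V)) = card ((\<lambda>v. reach d F `` {v}) ` V)"
proof -
  define C where "C w = reach d F `` {w}" for w
  have neq: "C u \<noteq> C v" using new by (simp add: C_def reach_class_eq_iff)
  have C_eq: "C w = C z" if "z \<in> C w" for w z
    using that by (simp add: C_def reach_class_eq_iff)
  have self: "w \<in> C w" for w by (simp add: C_def)
  have *: "reach d (insert e F) `` {w} = (if w \<in> C u \<union> C v then C u \<union> C v else C w)" for w
  proof (cases "w \<in> C u \<union> C v")
    case True
    then have "C w \<subseteq> C u \<union> C v" using C_eq by blast
    then show ?thesis using True reach_insert[where d = d and e = e, OF e, of w _ F] by (auto simp: C_def)
  qed (use reach_insert[where d = d and e = e, OF e, of w _ F] in \<open>auto simp: C_def\<close>)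
  have "(\<lambda>v. reach d (insert e F) `` {v}) ` V = insert (C u \<union> C v) (C ` V - {C u, C v})"
  proof (intro equalityI subsetI)
    fix X assume "X \<in> (\<lambda>v. reach d (insert e F) `` {v}) ` V"
    then obtain w where w: "w \<in> V" "X = (if w \<in> C u \<union> C v then C u \<union> C v else C w)"
      using * by auto
    show "X \<in> insert (C u \<union> C v) (C ` V - {C u, C v})"
      using w self[of w] by auto
  next
    fix X assume X: "X \<in> insert (C u \<union> C v) (C ` V - {C u, C v})"
    show "X \<in> (\<lambda>v. reach d (insert e F) `` {v}) ` V"
    proof (cases "X = C u \<union> C v")
      case True
      then have "X = reach d (insert e F) `` {u}" using *[of u] self[of u] by simp
      then show ?thesis using V by blast
    next
      case False
      then obtain w where w: "w \<in> V" "X = C w" "C w \<noteq> C u" "C w \<noteq> C v" using X by auto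
      then have "w \<notin> C u \<union> C v" using C_eq by blast
      then have "X = reach d (insert e F) `` {w}" using *[of w] w by simp
      then show ?thesis using w by blast
    qed
  qed
  moreover have "C u \<union> C v \<notin> C ` V - {C u, C v}"
    using C_eq self by blast
  moreover have "card (C ` V) = Suc (Suc (card (C ` V - {C u, C v})))"
  proof -
    have "card (C ` V - {C u, C v}) = card (C ` V) - card {C u, C v}"
      by (rule card_Diff_subset) (use V in auto)
    moreover have "card {C u, C v} \<le> card (C ` V)" by (rule card_mono) (use V in auto)
    ultimately show ?thesis using neq by simp
  qed
  ultimately show ?thesis using V by (simp add: C_def)
qed

lemma graph_rank_insert:
  assumes "finite V" "u \<in> V" "v \<in> V" "d e = {u, v}"
  shows "graph_rank d V (insert e F) =
    (if (u, v) \<in> reach d F then graph_rank d V F else Suc (graph_rank d V F))"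
proof (cases "(u, v) \<in> reach d F")
  case True
  then show ?thesis by (simp add: graph_rank_def reach_insert_redundant[where d = d and e = e, OF assms(4)])
next
  case False
  have "card ((\<lambda>v. reach d F `` {v}) ` V) \<le> card V" using assms by (simp add: card_image_le)
  then show ?thesis
    using card_classes_insert[of V u v d e F] assms False by (simp add: graph_rank_def)
qed

lemma reach_empty: "reach d {} = Id"
  by (simp add: reach_def)

lemma graph_rank_empty: "graph_rank d V {} = 0"
proof -
  have "card ((\<lambda>v. reach d {} `` {v}) ` V) = card V"
    by (rule card_image) (auto simp: reach_empty inj_on_def)
  then show ?thesis by (simp add: graph_rank_def)
qed

lemma ex_two_ends: "card X = 2 \<Longrightarrow> \<exists>u v. X = {u, v} \<and> u \<noteq> v"
  by (auto simp: card_2_iff)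

text \<open>Each increment of the rank depends on reachability alone, which does not see the vertex
  set. This allows passing from \<open>verts G\<close> to the vertices covered by a
  subgraph.\<close>

lemma graph_rank_verts:
  assumes "finite F" "finite V" "finite W" "\<And>e. e \<in> F \<Longrightarrow> d e \<subseteq> V \<inter> W \<and> card (d e) = 2"
  shows "graph_rank d V F = graph_rank d W F"
  using assms(1,4)
proof (induction F)
  case (insert e F)
  then obtain u v where uv: "d e = {u, v}" using ex_two_ends by blast
  then have "u \<in> V" "v \<in> V" "u \<in> W" "v \<in> W" using insert.prems[of e] by auto
  then show ?case using uv insert assms(2,3) graph_rank_insert[of V u v d e F] graph_rank_insert[of W u v d e F]
    by auto
qed (simp add: graph_rank_empty)

lemma graph_rank_connected_iff:
  assumes "finite V" "V \<noteq> {}"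
  shows "Suc (graph_rank d V F) = card V \<longleftrightarrow> (\<forall>u\<in>V. \<forall>v\<in>V. (u, v) \<in> reach d F)"
proof -
  let ?C = "(\<lambda>v. reach d F `` {v}) ` V"
  have "card ?C \<le> card V" "0 < card ?C" using assms by (auto simp: card_image_le card_gt_0_iff)
  then have "Suc (graph_rank d V F) = card V \<longleftrightarrow> card ?C = 1"
    by (auto simp: graph_rank_def)
  also have "\<dots> \<longleftrightarrow> (\<forall>u\<in>V. \<forall>v\<in>V. reach d F `` {u} = reach d F `` {v})"
  proof
    assume "card ?C = 1"
    then obtain c where "?C = {c}" by (auto simp: card_1_singleton_iff)
    then show "\<forall>u\<in>V. \<forall>v\<in>V. reach d F `` {u} = reach d F `` {v}" by (metis imageI singletonD)
  next
    assume *: "\<forall>u\<in>V. \<forall>v\<in>V. reach d F `` {u} = reach d F `` {v}"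
    obtain u where "u \<in> V" using assms by auto
    then have "?C = {reach d F `` {u}}" using * by blast
    then show "card ?C = 1" by simp
  qed
  finally show ?thesis by (simp add: reach_class_eq_iff)
qed

section \<open>Cycles and redundant edges\<close>

lemma reach_simple_path:
  assumes "(u, v) \<in> reach d F"
  shows "\<exists>vs es. length vs = Suc (length es) \<and> distinct vs \<and> vs ! 0 = u \<and> vs ! length es = v \<and>
    set es \<subseteq> F \<and> (\<forall>i<length es. d (es ! i) = {vs ! i, vs ! Suc i})"
  using assms unfolding reach_def
proof (induction rule: converse_rtrancl_induct)
  case base
  show ?case by (intro exI[of _ "[v]"] exI[of _ "[]"]) simp
next
  case (step y z)
  then obtain e where e: "e \<in> F" "d e = {y, z}" by auto
  obtain vs es where p: "length vs = Suc (length es)" "distinct vs" "vs ! 0 = z"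
    "vs ! length es = v" "set es \<subseteq> F" "\<forall>i<length es. d (es ! i) = {vs ! i, vs ! Suc i}"
    using step.IH by auto
  show ?case
  proof (cases "y \<in> set vs")
    \<comment> \<open>The new vertex \<open>y\<close> already lies on the path, so the path is cut
      to start there.\<close>
    case True
    then obtain k where k: "k < length vs" "vs ! k = y" by (auto simp: in_set_conv_nth)
    have "d (drop k es ! i) = {drop k vs ! i, drop k vs ! Suc i}" if "i < length (drop k es)" for i
      using that p k by auto
    moreover have "set (drop k es) \<subseteq> F" using p(5) set_drop_subset by fast
    ultimately show ?thesis using p k
      by (intro exI[of _ "drop k vs"] exI[of _ "drop k es"]) auto
  next
    case False
    have "d ((e # es) ! i) = {(y # vs) ! i, (y # vs) ! Suc i}" if "i < length (e # es)" for i
      using that p e by (cases i) auto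
    then show ?thesis using p e False
      by (intro exI[of _ "y # vs"] exI[of _ "e # es"]) auto
  qed
qed

lemma is_cycle_redundant_edge:
  assumes C: "is_cycle G C" and two: "\<And>e. e \<in> C \<Longrightarrow> card (ends G e) = 2"
  shows "\<exists>e\<in>C. \<exists>u v. ends G e = {u, v} \<and> (u, v) \<in> reach (ends G) (C - {e})"
proof -
  obtain vs es where c: "es \<noteq> []" "length vs = length es" "distinct vs" "distinct es" "set es = C"
    "\<And>i. i < length es \<Longrightarrow> ends G (es ! i) = {vs ! i, vs ! (Suc i mod length es)}"
    using C by (auto simp: is_cycle_def)
  \<comment> \<open>\<open>k\<close> is the last index, the only one at which the successor wraps
    around. The other edges form a path from \<open>vs ! 0\<close> to \<open>vs ! k\<close>, which
    makes the edge at \<open>k\<close> redundant.\<close>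
  define k where "k = length es - 1"
  have k: "Suc k = length es" using c(1) by (simp add: k_def)
  have path: "(vs ! 0, vs ! i) \<in> reach (ends G) (C - {es ! k})" if "i \<le> k" for i
    using that
  proof (induction i)
    case (Suc i)
    have "es ! i \<noteq> es ! k" using Suc.prems c(4) k by (simp add: nth_eq_iff_index_eq)
    moreover have "es ! i \<in> C" using c(5) Suc.prems k by auto
    moreover have "ends G (es ! i) = {vs ! i, vs ! Suc i}" using c(6)[of i] Suc.prems k by simp
    ultimately have "(vs ! i, vs ! Suc i) \<in> reach (ends G) (C - {es ! k})"
      by (auto intro: reach_edge)
    then show ?case using Suc by (auto intro: reach_trans)
  qed simp
  have "es ! k \<in> C" using c(5) k by auto
  moreover have "ends G (es ! k) = {vs ! 0, vs ! k}" using c(6)[of k] k by (simp add: insert_commute)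
  ultimately show ?thesis using path[of k] by blast
qed

lemma is_cycle_of_redundant_edge:
  assumes e: "e \<in> T" "ends G e = {u, v}" "(u, v) \<in> reach (ends G) (T - {e})"
  shows "\<exists>C. is_cycle (G\<lparr>edges := T\<rparr>) C"
proof -
  obtain vs es where p: "length vs = Suc (length es)" "distinct vs" "vs ! 0 = u"
    "vs ! length es = v" "set es \<subseteq> T - {e}"
    "\<And>i. i < length es \<Longrightarrow> ends G (es ! i) = {vs ! i, vs ! Suc i}"
    using reach_simple_path[OF e(3)] by auto
  \<comment> \<open>Two edges of a path without repeated vertices that have the same pair of ends
    stand at the same position.\<close>
  have "distinct es"
    unfolding distinct_conv_nth
  proof (intro allI impI notI)
    fix i j assume ij: "i < length es" "j < length es" "i \<noteq> j" "es ! i = es ! j"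
    then have "{vs ! i, vs ! Suc i} = {vs ! j, vs ! Suc j}" using p(6)[of i] p(6)[of j] by simp
    then show False using ij p(1,2) by (auto simp: doubleton_eq_iff nth_eq_iff_index_eq)
  qed
  then have "distinct (es @ [e])" using p(5) by auto
  moreover have "ends G ((es @ [e]) ! i) = {vs ! i, vs ! (Suc i mod length (es @ [e]))}"
    if "i < length (es @ [e])" for i
  proof (cases "i < length es")
    case True
    then show ?thesis using p(6)[of i] by (simp add: nth_append)
  next
    case False
    then have "i = length es" using that by simp
    then show ?thesis using p(3,4) e(2) by (simp add: insert_commute)
  qed
  ultimately have "is_cycle (G\<lparr>edges := T\<rparr>) (set (es @ [e]))"
    unfolding is_cycle_def using p e(1)
    by (intro conjI exI[of _ vs] exI[of _ "es @ [e]"]) auto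
  then show ?thesis by blast
qed

section \<open>The graphical matroid of a connected multigraph\<close>

locale connected_multigraph =
  fixes G :: "('v, 'e) multigraph"
  assumes multigraph: "multigraph G" and connected: "connected_graph G"
begin

abbreviation \<rho> :: "'e set \<Rightarrow> nat" where
  "\<rho> \<equiv> graph_rank (ends G) (verts G)"

lemma finite_verts: "finite (verts G)" and finite_edges: "finite (edges G)"
  using multigraph by (auto simp: multigraph_def)

lemma two_ends:
  assumes "e \<in> edges G"
  obtains u v where "ends G e = {u, v}" "u \<noteq> v" "u \<in> verts G" "v \<in> verts G"
  using assms multigraph ex_two_ends[of "ends G e"] unfolding multigraph_def by (metis insert_subset)

lemma rank_insert:
  assumes "e \<in> edges G" "ends G e = {u, v}"
  shows "\<rho> (insert e F) = (if (u, v) \<in> reach (ends G) F then \<rho> F else Suc (\<rho> F))"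
  by (rule graph_rank_insert)
    (use finite_verts assms multigraph in \<open>auto simp: multigraph_def\<close>)

text \<open>An edge raises the rank exactly if its ends are not yet connected. Being spanned is
  therefore inherited by larger sets, because reachability is monotone.\<close>

sublocale rank_increments "edges G" \<rho>
proof
  fix F F' e
  show "\<rho> (insert e F) = \<rho> F \<or> \<rho> (insert e F) = Suc (\<rho> F)" if e: "e \<in> edges G"
    using two_ends[OF e] rank_insert[OF e] by metis
  show "\<rho> (insert e F') = \<rho> F'" if e: "F \<subseteq> F'" "e \<in> edges G" "\<rho> (insert e F) = \<rho> F"
    using two_ends[OF e(2)] rank_insert[OF e(2)] reach_mono[OF e(1), of "ends G"] e(3)
    by (metis n_not_Suc_n subsetD)
qed (simp_all add: finite_edges graph_rank_empty)

lemma connected_iff_rank: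
  "connected_graph (G\<lparr>edges := T\<rparr>) \<longleftrightarrow> Suc (\<rho> T) = card (verts G)"
proof -
  have "verts G \<noteq> {}" using connected by (auto simp: connected_graph_def)
  moreover have "(adjacency (G\<lparr>edges := T\<rparr>))\<^sup>* = reach (ends G) T"
    by (simp add: adjacency_def reach_def)
  ultimately show ?thesis
    using graph_rank_connected_iff[OF finite_verts] by (auto simp: connected_graph_def)
qed

lemma Suc_rank_edges: "Suc (\<rho> (edges G)) = card (verts G)"
  using connected_iff_rank[of "edges G"] connected by simp

text \<open>Both sides say that no edge of \<open>T\<close> has its ends joined by the rest of
  \<open>T\<close>: such an edge closes a cycle with a simple path, and every cycle contains
  one.\<close>

lemma acyclic_iff_rank:
  assumes T: "T \<subseteq> edges G"
  shows "(\<nexists>C. is_cycle (G\<lparr>edges := T\<rparr>) C) \<longleftrightarrow> \<rho> T = card T"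
proof (intro iffI notI)
  assume acyclic: "\<nexists>C. is_cycle (G\<lparr>edges := T\<rparr>) C"
  show "\<rho> T = card T"
  proof (rule ccontr)
    assume "\<rho> T \<noteq> card T"
    then obtain e where e: "e \<in> T" "\<rho> (T - {e}) = \<rho> T" using ex_redundant[OF T] by blast
    obtain u v where uv: "ends G e = {u, v}" using two_ends e T by (metis subsetD)
    have "\<rho> (insert e (T - {e})) = \<rho> (T - {e})" using e by (simp add: insert_absorb)
    moreover have "e \<in> edges G" using e T by auto
    ultimately have "(u, v) \<in> reach (ends G) (T - {e})"
      using rank_insert[OF _ uv, of "T - {e}"] by (metis n_not_Suc_n)
    then show False using is_cycle_of_redundant_edge[OF e(1) uv] acyclic by blast
  qed
next
  assume *: "\<rho> T = card T" "\<exists>C. is_cycle (G\<lparr>edges := T\<rparr>) C"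
  then obtain C where C: "is_cycle (G\<lparr>edges := T\<rparr>) C" by auto
  then have CT: "C \<subseteq> T" by (simp add: is_cycle_def)
  obtain e u v where e: "e \<in> C" "ends G e = {u, v}" "(u, v) \<in> reach (ends G) (C - {e})"
  proof -
    have "card (ends G e) = 2" if "e \<in> C" for e
      using that CT T multigraph by (auto simp: multigraph_def)
    then show ?thesis using is_cycle_redundant_edge[OF C] that by auto
  qed
  have "(u, v) \<in> reach (ends G) (T - {e})" using e(3) CT reach_mono[of "C - {e}" "T - {e}"] by auto
  then have "\<rho> (insert e (T - {e})) = \<rho> (T - {e})"
    using rank_insert[of e u v "T - {e}"] e CT T by auto
  then have "\<rho> T = \<rho> (T - {e})" using e CT by (auto simp: insert_absorb)
  also have "\<dots> \<le> card (T - {e})" using T by (intro le_card) auto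
  also have "\<dots> < card T"
    using e CT T finite_edges finite_subset by (metis card_Diff1_less subsetD)
  finally show False using * by simp
qed

lemma graphical_matroid_eq: "graphical_matroid G = to_matroid"
proof -
  have "spanning_tree G T \<longleftrightarrow> T \<subseteq> edges G \<and> \<rho> T = card T \<and> \<rho> T = \<rho> (edges G)" for T
    using acyclic_iff_rank[of T] Suc_rank_edges connected_iff_rank[of T]
    unfolding spanning_tree_def by (metis Suc_inject)
  then show ?thesis by (simp add: graphical_matroid_def to_matroid_def)
qed

lemma greedy_matroid_graphical: "greedy_matroid (graphical_matroid G)"
  using greedy_matroid_to_matroid graphical_matroid_eq by simp

lemma mrank_graphical: "X \<subseteq> edges G \<Longrightarrow> mrank (graphical_matroid G) X = \<rho> X"
  using mrank_to_matroid graphical_matroid_eq by simp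

text \<open>Identifies the bound n_H - 1 of a locked subgraph with a rank. If the covered vertices
  fell into several components, the edges of one component would separate the restriction.\<close>

lemma card_verts_eq_Suc_rank:
  assumes L: "L \<subseteq> edges G" and conn: "two_connected (restriction (graphical_matroid G) L)"
  shows "card (\<Union>e\<in>L. ends G e) = Suc (\<rho> L)"
proof -
  interpret M: greedy_matroid "graphical_matroid G" by (rule greedy_matroid_graphical)
  have ground: "ground (graphical_matroid G) = edges G" by (simp add: graphical_matroid_def)
  have L0: "L \<noteq> {}" and sep: "\<And>X. X \<noteq> {} \<Longrightarrow> X \<subset> L \<Longrightarrow> \<rho> L \<noteq> \<rho> X + \<rho> (L - X)"
    using M.connected_restriction_iff[of L] L conn ground mrank_graphical
    by (simp_all add: psubset_imp_subset subset_trans[OF _ L] Diff_subset[THEN subset_trans])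
  define W where "W = (\<Union>e\<in>L. ends G e)"
  let ?d = "ends G"
  have W: "W \<subseteq> verts G" using L multigraph by (auto simp: W_def multigraph_def)
  have finW: "finite W" using W finite_verts finite_subset by auto
  have "W \<noteq> {}" using L0 L multigraph by (fastforce simp: W_def multigraph_def)
  have rank_W: "\<rho> L = graph_rank ?d W L"
  proof (rule graph_rank_verts)
    show "?d e \<subseteq> verts G \<inter> W \<and> card (?d e) = 2" if "e \<in> L" for e
      using that L multigraph by (auto simp: multigraph_def W_def)
  qed (use finW finite_verts L finite_edges finite_subset in auto)
  have "(u, v) \<in> reach ?d L" if uv: "u \<in> W" "v \<in> W" for u v
  proof (rule ccontr)
    assume nreach: "(u, v) \<notin> reach ?d L"
    \<comment> \<open>\<open>A\<close> is the component of \<open>u\<close> and \<open>X\<close> its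
      set of edges. An edge at \<open>u\<close> lies in \<open>X\<close>, an edge at
      \<open>v\<close> does not, so \<open>X\<close> is a candidate for a separator.\<close>
    define A where "A = reach ?d L `` {u}"
    define X where "X = {e \<in> L. ?d e \<subseteq> A}"
    have XL: "X \<subseteq> L" by (auto simp: X_def)
    have A_closed: "?d e \<subseteq> A" if e: "e \<in> L" "?d e \<inter> A \<noteq> {}" for e
    proof -
      obtain a b where ab: "?d e = {a, b}" using two_ends e L by (metis subsetD)
      then have "(a, b) \<in> reach ?d L" using e by (auto intro: reach_edge)
      then show ?thesis using e(2) ab reach_sym[of a b ?d L] reach_trans[of u a ?d L b] reach_trans[of u b ?d L a]
        unfolding A_def by auto
    qed
    have uA: "u \<in> A" and vA: "v \<notin> A" using nreach by (auto simp: A_def)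
    have "X \<noteq> {}" using uv(1) uA A_closed by (fastforce simp: W_def X_def)
    moreover have "X \<noteq> L" using uv(2) vA by (auto simp: W_def X_def)
    \<comment> \<open>The edges off \<open>A\<close> are added one at a time. A walk starting off
      \<open>A\<close> never uses an edge of \<open>X\<close>, so each of them raises the rank in
      the presence of \<open>X\<close> exactly if it does so without.\<close>
    moreover have "\<rho> (X \<union> F) = \<rho> X + \<rho> F" if "finite F" "F \<subseteq> L - X" for F
      using that
    proof (induction F)
      case (insert e F)
      have "e \<in> L" "\<not> ?d e \<subseteq> A" using insert.prems by (auto simp: X_def)
      then have e: "e \<in> L" "?d e \<inter> A = {}" using A_closed by blast+
      obtain a b where ab: "?d e = {a, b}" using two_ends e L by (metis subsetD)
      have outside: "w \<notin> A \<and> (a, w) \<in> reach ?d F" if "(a, w) \<in> reach ?d (X \<union> F)" for w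
        using that
      proof (induction rule: reach_induct)
        case refl
        then show ?case using e ab by auto
      next
        case (step y z f)
        then have "f \<in> F" by (auto simp: X_def doubleton_eq_iff)
        then have "f \<in> L" "\<not> ?d f \<subseteq> A" using insert.prems by (auto simp: X_def)
        then have "?d f \<inter> A = {}" using A_closed by blast
          then show ?case using step \<open>f \<in> F\<close> reach_edge[of f F ?d y z] reach_trans[of a y ?d F z] by auto
      qed
      have "(a, b) \<in> reach ?d (X \<union> F) \<longleftrightarrow> (a, b) \<in> reach ?d F"
        using outside[of b] reach_mono[of F "X \<union> F" ?d] by auto
      then show ?case
        using insert rank_insert[of e a b "X \<union> F"] rank_insert[of e a b F] e L ab by auto
    qed simp
    from this[of "L - X"] have "\<rho> L = \<rho> X + \<rho> (L - X)"
      using XL L finite_edges finite_subset by (simp add: Un_absorb1 finite_subset)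
    ultimately show False using sep[of X] XL by auto
  qed
  then show ?thesis
    using graph_rank_connected_iff[OF finW \<open>W \<noteq> {}\<close>, of ?d L] rank_W by (auto simp: W_def)
qed

end

section \<open>Minimality\<close>

text \<open>Modulo \<open>x(E) = r(E)\<close> both forms mean \<open>x(L) \<le> r(L)\<close>; the second is the form of the constraint of an
  essential coparallel closure \<open>- L\<close>.\<close>

definition flacet_halfspace :: "'e::finite matroid \<Rightarrow> (real ^ 'e) set \<Rightarrow> 'e set \<Rightarrow> bool" where
  "flacet_halfspace M C L \<longleftrightarrow> flacet M L \<and> (C = {x. esum x L \<le> mrank M L} \<or>
     C = {x. esum x (- L) \<ge> real (mrank M UNIV) - mrank M L})"

context finite_type_matroid
begin

lemma flacet_halfspace_iff:
  assumes "flacet_halfspace M C L" "esum x UNIV = mrank M UNIV"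
  shows "x \<in> C \<longleftrightarrow> esum x L \<le> mrank M L"
  using assms by (auto simp: flacet_halfspace_def esum_Compl)

text \<open>For two different flacets, \<open>ex_violating_only\<close> supplies a point of the
  hyperplane that lies in only one of the two half-spaces.\<close>

lemma flacet_halfspace_unique:
  assumes M: "two_connected M" and C: "flacet_halfspace M C L" and D: "flacet_halfspace M D L'"
    and same: "\<And>x. esum x UNIV = mrank M UNIV \<Longrightarrow> x \<in> C \<longleftrightarrow> x \<in> D"
  shows "L = L'"
proof (rule ccontr)
  assume "L \<noteq> L'"
  have "flacet M L" "flacet M L'" using C D by (auto simp: flacet_halfspace_def)
  then obtain x where "esum x UNIV = mrank M UNIV" "esum x L > mrank M L" "esum x L' \<le> mrank M L'"
    using ex_violating_only[OF M, of L] \<open>L \<noteq> L'\<close> by blast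
  then show False using flacet_halfspace_iff[OF C] flacet_halfspace_iff[OF D] same by force
qed

lemma Inter_flacets:
  assumes M: "two_connected M"
    and label: "\<And>C. C \<in> J \<Longrightarrow> \<exists>L. flacet_halfspace M C L"
    and all: "\<And>L. flacet M L \<Longrightarrow> \<exists>C\<in>J. flacet_halfspace M C L"
  shows "\<Inter>({{x. esum x UNIV = mrank M UNIV}} \<union> J) = base_polytope M"
proof (intro set_eqI iffI)
  fix x
  assume "x \<in> \<Inter>({{x. esum x UNIV = mrank M UNIV}} \<union> J)"
  then have x: "esum x UNIV = mrank M UNIV" "\<And>C. C \<in> J \<Longrightarrow> x \<in> C" by auto
  have "esum x L \<le> mrank M L" if "flacet M L" for L
    using all[OF that] x flacet_halfspace_iff by blast
  then show "x \<in> base_polytope M" using base_polytope_flacets[OF M] x by blast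
next
  fix x
  assume x: "x \<in> base_polytope M"
  have "x \<in> C" if "C \<in> J" for C
    using label[OF that] flacet_halfspace_iff base_polytope_total[OF x] base_polytope_le_rank[OF x] by blast
  then show "x \<in> \<Inter>({{x. esum x UNIV = mrank M UNIV}} \<union> J)"
    using base_polytope_total[OF x] by auto
qed

text \<open>\<open>J\<close> is left abstract so as to cover both the full list and a selection from
  it. By \<open>inj\<close> the other members belong to other flacets, so the point violating
  \<open>L\<close> alone satisfies all of them.\<close>

lemma minimal_description_flacets:
  assumes M: "two_connected M"
    and label: "\<And>C. C \<in> J \<Longrightarrow> \<exists>L. flacet_halfspace M C L"
    and all: "\<And>L. flacet M L \<Longrightarrow> \<exists>C\<in>J. flacet_halfspace M C L"
    and inj: "\<And>C D L. C \<in> J \<Longrightarrow> D \<in> J \<Longrightarrow> flacet_halfspace M C L \<Longrightarrow> flacet_halfspace M D L \<Longrightarrow> C = D"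
  shows "minimal_description {{x. esum x UNIV = mrank M UNIV}} J (base_polytope M)"
proof -
  let ?H = "{x. esum x UNIV = mrank M UNIV}"
  obtain z where z: "esum z UNIV > mrank M UNIV"
    "\<And>L. flacet M L \<Longrightarrow> esum z L \<le> mrank M L \<and> real (mrank M UNIV) - mrank M L \<le> esum z (- L)"
    using ex_violating_total[OF M] by blast
  have "z \<in> C" if "C \<in> J" for C using label[OF that] z(2) by (auto simp: flacet_halfspace_def)
  moreover have "z \<notin> base_polytope M" using z(1) base_polytope_total[of z] by auto
  ultimately have "\<Inter>(({?H} - {?H}) \<union> J) \<noteq> base_polytope M" by auto
  moreover have "\<Inter>({?H} \<union> (J - {C})) \<noteq> base_polytope M" if C: "C \<in> J" for C
  proof -
    obtain L where L: "flacet_halfspace M C L" using label[OF C] by auto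
    then have "flacet M L" by (simp add: flacet_halfspace_def)
    then obtain x where x: "esum x UNIV = mrank M UNIV" "esum x L > mrank M L"
      "\<And>L'. flacet M L' \<Longrightarrow> L' \<noteq> L \<Longrightarrow> esum x L' \<le> mrank M L'"
      using ex_violating_only[OF M] by blast
    have "x \<in> D" if D: "D \<in> J - {C}" for D
    proof -
      obtain L' where L': "flacet_halfspace M D L'" using label D by auto
      then have "L' \<noteq> L" using inj[OF C, of D L] L D by auto
      then show ?thesis using flacet_halfspace_iff[OF L' x(1)] x(3)[of L'] L' by (simp add: flacet_halfspace_def)
    qed
    moreover have "x \<notin> base_polytope M" using base_polytope_le_rank[of x L] x(2) by auto
    ultimately show ?thesis using x(1) by auto
  qed
  ultimately show ?thesis
    unfolding minimal_description_def using Inter_flacets[OF M label all] by auto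
qed

end

section \<open>Flacets and closures\<close>

context greedy_matroid
begin

text \<open>A loop would be a separator by itself. The matroid on one element is excluded because
  that element may be a loop.\<close>

lemma rank_singleton:
  assumes "two_connected M" "e \<in> ground M" "ground M \<noteq> {e}"
  shows "mrank M {e} = 1"
proof -
  have "mrank M {e} \<noteq> 0"
  proof
    assume 0: "mrank M {e} = 0"
    have "mrank M ({e} \<union> (ground M - {e})) \<le> mrank M {e} + mrank M (ground M - {e})"
      using rank_submodular[of "{e}" "ground M - {e}"] assms by simp
    moreover have "{e} \<union> (ground M - {e}) = ground M" using assms by auto
    moreover have "mrank M (ground M - {e}) \<le> mrank M (ground M)" by (rule rank_mono) auto
    ultimately show False using connectedD[OF assms(1), of "{e}"] assms 0 by auto
  qed
  then show ?thesis using rank_le_card[of "{e}"] assms by auto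
qed

text \<open>Both parts of a partition into nonempty sets have rank at least 1, and the whole has
  rank only 1.\<close>

lemma parallel_set_connected:
  assumes "parallel_set M P"
  shows "P \<noteq> {}" "two_connected (restriction M P)"
proof -
  have P: "P \<subseteq> ground M" "mrank M P = 1" "\<And>e. e \<in> P \<Longrightarrow> mrank M {e} = 1"
    using assms by (auto simp: parallel_set_def)
  show "P \<noteq> {}" using P(2) by auto
  have pos: "mrank M X \<ge> 1" if X: "X \<noteq> {}" "X \<subseteq> P" for X
  proof -
    obtain e where "e \<in> X" using X(1) by blast
    moreover from this have "e \<in> P" "X \<subseteq> ground M" using X P(1) by auto
    ultimately show ?thesis using rank_mono[of "{e}" X] P(3)[of e] by auto
  qed
  have "mrank M P \<noteq> mrank M X + mrank M (P - X)" if "X \<noteq> {}" "X \<subset> P" for X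
  proof -
    have "P - X \<noteq> {}" "P - X \<subseteq> P" "X \<subseteq> P" using that by blast+
    then show ?thesis using pos[of X] pos[of "P - X"] that(1) P(2) by linarith
  qed
  then show "two_connected (restriction M P)"
    using connected_restriction_iff[OF P(1)] \<open>P \<noteq> {}\<close> by blast
qed

lemma flacet_of_parallel_closure:
  assumes "essential_parallel_closure M P"
  shows "flacet M P" "mrank M P = 1"
  using assms parallel_set_connected two_connected_contraction_iff[OF greedy_matroid_axioms]
  by (auto simp: essential_parallel_closure_def parallel_closure_def flacet_def parallel_set_def)


lemma flacet_of_coparallel_closure:
  assumes "essential_coparallel_closure M S"
  shows "flacet M (ground M - S)" "S \<subseteq> ground M" "mrank (dual M) S = 1"
proof -
  interpret D: greedy_matroid "dual M" by (rule greedy_matroid_dual)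
  have S: "parallel_set (dual M) S" "two_connected (restriction M (ground M - S))"
    using assms
    by (auto simp: essential_coparallel_closure_def coparallel_closure_def parallel_closure_def deletion_def)
  show "S \<subseteq> ground M" "mrank (dual M) S = 1" using S by (auto simp: parallel_set_def)
  moreover from this have "ground M - (ground M - S) = S" by auto
  ultimately show "flacet M (ground M - S)"
    using S D.parallel_set_connected(2)[OF S(1)] by (simp add: flacet_def)
qed

lemma flacet_of_locked: "locked M L \<Longrightarrow> flacet M L"
  by (auto simp: locked_def flacet_def)

text \<open>Flacets are closed: an element spanned by \<open>L\<close> would be a loop of M/L and
  hence a separator of it, unless M/L consists of this element alone.\<close>

lemma rank_insert_outside_flacet:
  assumes L: "flacet M L" and e: "e \<in> ground M - L" "ground M - L \<noteq> {e}"
  shows "mrank M (insert e L) \<noteq> mrank M L"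
proof
  assume eq: "mrank M (insert e L) = mrank M L"
  have "mrank M L + mrank M (ground M) \<le> mrank M (insert e L) + mrank M (ground M - {e})"
    by (rule rank_submodularI) (use e flacetD(1)[OF L] in auto)
  moreover have "mrank M (ground M - {e}) \<le> mrank M (ground M)" by (rule rank_mono) auto
  ultimately show False using flacetD(5)[OF L, of "{e}"] eq e by auto
qed

lemma parallel_set_if_rank_1:
  assumes M: "two_connected M" and L: "L \<subseteq> ground M" "mrank M L = 1" "L \<noteq> ground M"
  shows "parallel_set M L"
proof -
  have "mrank M {e} = 1" if "e \<in> L" for e
  proof -
    have "ground M \<noteq> {e}" using that L by (auto simp: subset_singleton_iff)
    then show ?thesis using rank_singleton[OF M, of e] that L by auto
  qed
  then show ?thesis using L by (auto simp: parallel_set_def)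
qed

text \<open>Maximality of \<open>L\<close> as a parallel set holds because flacets are closed.
  \<open>large\<close> excludes the exception, where M/L is a single loop and the missing element is
  parallel to \<open>L\<close>.\<close>

lemma flacet_rank_1:
  assumes M: "two_connected M" and L: "flacet M L" "mrank M L = 1"
    and large: "\<not> (mrank M (ground M) = 1 \<and> card (ground M - L) = 1)"
  shows "essential_parallel_closure M L"
proof -
  note fl = flacetD(1-3)[OF L(1)]
  have "parallel_set M L" by (rule parallel_set_if_rank_1) (use M L fl in auto)
  moreover have "Q = L" if Q: "parallel_set M Q" "L \<subseteq> Q" for Q
  proof (rule ccontr)
    assume "Q \<noteq> L"
    then obtain e where e: "e \<in> Q" "e \<notin> L" using Q by auto
    have QE: "Q \<subseteq> ground M" "mrank M Q = 1" using Q by (auto simp: parallel_set_def)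
    have "mrank M L \<le> mrank M (insert e L)" "mrank M (insert e L) \<le> mrank M Q"
      by (rule rank_mono; use Q e QE in auto)+
    then have "ground M - L = {e}" using rank_insert_outside_flacet[OF L(1), of e] L QE e by force
    moreover from this have "Q = ground M" using e QE Q by auto
    ultimately show False using large QE by auto
  qed
  ultimately show ?thesis
    using L(1) two_connected_contraction_iff[OF greedy_matroid_axioms]
    by (auto simp: essential_parallel_closure_def parallel_closure_def flacet_def)
qed

end

lemma dual_dual:
  assumes "\<And>B. B \<in> bases M \<Longrightarrow> B \<subseteq> ground M"
  shows "dual (dual M) = M"
proof -
  have "C \<in> bases (dual (dual M)) \<longleftrightarrow> (\<exists>B\<in>bases M. C = ground M - (ground M - B))" for C
    by (auto simp: dual_def)
  then have "bases (dual (dual M)) = bases M"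
    using assms by (auto simp: double_diff)
  then show ?thesis by (simp add: dual_def)
qed

context greedy_matroid
begin

lemma flacet_dual:
  assumes "flacet M L"
  shows "flacet (dual M) (ground M - L)"
proof -
  have "ground M - (ground M - L) = L" using assms by (auto simp: flacet_def)
  then show ?thesis using assms dual_dual[OF basis_subset] by (simp add: flacet_def)
qed

lemma flacet_corank_1:
  assumes M: "two_connected M" and L: "flacet M L" "mrank (dual M) (ground M - L) = 1"
    and large: "\<not> (mrank (dual M) (ground M) = 1 \<and> card L = 1)"
  shows "essential_coparallel_closure M (ground M - L)"
proof -
  interpret D: greedy_matroid "dual M" by (rule greedy_matroid_dual)
  have LL: "ground M - (ground M - L) = L" using flacetD(1)[OF L(1)] by auto
  have "essential_parallel_closure (dual M) (ground M - L)"
    using D.flacet_rank_1[OF _ flacet_dual[OF L(1)] L(2)] M two_connected_dual_iff large LL by simp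
  then show ?thesis using L(1) LL
    by (simp add: essential_parallel_closure_def essential_coparallel_closure_def
      coparallel_closure_def deletion_def flacet_def)
qed

text \<open>The excluded matroid of rank 1 on two elements is that of the digon: each single element
  is a flacet, but the only closure is the whole ground set.\<close>

lemma flacet_cases:
  assumes M: "two_connected M" and L: "flacet M L"
    and not_U12: "\<not> (mrank M (ground M) = 1 \<and> card (ground M) = 2)"
  shows "essential_parallel_closure M L \<or> essential_coparallel_closure M (ground M - L) \<or> locked M L"
proof -
  interpret D: greedy_matroid "dual M" by (rule greedy_matroid_dual)
  note fl = flacetD(1-3)[OF L]
  have fin: "finite L" using fl finite_ground finite_subset by auto
  have card: "card L + card (ground M - L) = card (ground M)"
    using fl fin finite_ground by (metis card_Diff_subset card_mono le_add_diff_inverse)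
  have pos: "mrank M L \<noteq> 0"
  proof -
    obtain e where e: "e \<in> L" using fl by auto
    moreover from this have "ground M \<noteq> {e}" using fl by (auto simp: subset_singleton_iff)
    ultimately have "mrank M {e} = 1" using rank_singleton[OF M, of e] fl by auto
    then show ?thesis using rank_mono[of "{e}" L] e fl by auto
  qed
  have copos: "mrank (dual M) (ground M - L) \<noteq> 0"
  proof -
    obtain e where e: "e \<in> ground M - L" using fl by auto
    moreover from this have "ground M \<noteq> {e}" using fl by (auto simp: subset_singleton_iff)
    ultimately have "mrank (dual M) {e} = 1"
      using D.rank_singleton[of e] two_connected_dual_iff M fl by auto
    then show ?thesis using D.rank_mono[of "{e}" "ground M - L"] e by auto
  qed
  have total: "mrank (dual M) (ground M) + mrank M (ground M) = card (ground M)"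
    using rank_dual[OF subset_refl] by simp
  \<comment> \<open>In rank 1 a flacet missing one element is not a maximal parallel set. Its
    inequality says that the missing coordinate is nonnegative, which is the constraint of an
    essential coparallel closure.\<close>
  have small: "mrank M (ground M) = 1 \<Longrightarrow> card (ground M - L) = 1 \<Longrightarrow> essential_coparallel_closure M (ground M - L)"
  proof -
    assume *: "mrank M (ground M) = 1" "card (ground M - L) = 1"
    have "mrank (dual M) (ground M - L) = 1"
      using D.rank_le_card[of "ground M - L"] * copos by auto
    then show ?thesis
      using flacet_corank_1[OF M L] * total card not_U12 by auto
  qed
  show ?thesis
  proof (cases "mrank M L = 1")
    case True
    then show ?thesis using flacet_rank_1[OF M L] small by auto
  next
    case rank: False
    show ?thesis
    proof (cases "mrank (dual M) (ground M - L) = 1")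
      case True
      \<comment> \<open>Rank at least 2 forces two elements in \<open>L\<close>, so the exception of
        \<open>flacet_corank_1\<close> does not arise.\<close>
      have "card L \<noteq> 1" using rank_le_card[OF fl(1)] rank pos by auto
      then show ?thesis using flacet_corank_1[OF M L True] by auto
    next
      case False
      then show ?thesis using rank pos copos L fl by (auto simp: locked_def flacet_def)
    qed
  qed
qed

end

section \<open>The constraints of a graph\<close>

lemma spanning_trees_polytope_eq: "spanning_trees_polytope G = base_polytope (graphical_matroid G)"
proof -
  have "{(\<chi> e. indicat_real T e) | T. spanning_tree G T} = charvec ` bases (graphical_matroid G)"
    by (auto simp: charvec_def graphical_matroid_def)
  then show ?thesis by (simp add: spanning_trees_polytope_def base_polytope_def)
qed

locale two_connected_multigraph =
  fixes G :: "('v, 'e::finite) multigraph"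
  assumes multigraph: "multigraph G" and edges: "edges G = UNIV" and two_connected: "two_connected_graph G"
begin

abbreviation M :: "'e matroid" where
  "M \<equiv> graphical_matroid G"

sublocale connected_multigraph G
  by unfold_locales (use multigraph two_connected in \<open>auto simp: two_connected_graph_def\<close>)

sublocale M: finite_type_matroid M
proof -
  interpret greedy_matroid M by (rule greedy_matroid_graphical)
  show "finite_type_matroid M" by unfold_locales (simp add: graphical_matroid_def edges)
qed

lemma two_connected_M: "two_connected M"
  using two_connected by (simp add: two_connected_graph_def)

lemma rank_UNIV: "real (mrank M UNIV) = real (card (verts G)) - 1"
  using mrank_graphical[of UNIV] Suc_rank_edges edges by simp

lemma tree_equations_eq: "tree_equations G = {{x. esum x UNIV = mrank M UNIV}}"
  by (simp add: tree_equations_def rank_UNIV edges)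

lemma card_verts_locked:
  assumes "locked M L"
  shows "real (card (\<Union>e\<in>L. ends G e)) - 1 = mrank M L"
  using card_verts_eq_Suc_rank[of L] mrank_graphical[of L] assms edges by (simp add: locked_def)

lemma locked_subgraphD:
  assumes "locked_subgraph H G"
  shows "locked M (edges H)" "real (card (verts H)) - 1 = mrank M (edges H)"
proof -
  show "locked M (edges H)" using assms by (simp add: locked_subgraph_def)
  moreover have "verts H = (\<Union>e\<in>edges H. ends G e)"
    using assms by (auto simp: locked_subgraph_def subgraph_def)
  ultimately show "real (card (verts H)) - 1 = mrank M (edges H)"
    using card_verts_locked by simp
qed

lemma locked_subgraph_of_locked:
  assumes "locked M L"
  shows "locked_subgraph \<lparr>verts = (\<Union>e\<in>L. ends G e), edges = L, ends = ends G\<rparr> G"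
  using assms multigraph edges
  by (auto simp: locked_subgraph_def subgraph_def multigraph_def intro: finite_subset[of _ "verts G"])

text \<open>The dual rank of \<open>S\<close> is 1, and \<open>rank_dual\<close> turns this into the
  right-hand side of the coparallel constraint.\<close>

lemma rank_coparallel:
  assumes "essential_coparallel_closure M S"
  shows "real (mrank M UNIV) - mrank M (- S) = real (card S) - 1"
  using M.rank_dual[of S] M.flacet_of_coparallel_closure(3)[OF assms] M.UNIV
  by (simp add: Compl_eq_Diff_UNIV)

text \<open>All constants become ranks, which brings the three families into the two forms of
  \<open>flacet_halfspace\<close>.\<close>

lemma tree_inequalities_iff:
  "C \<in> tree_inequalities G \<longleftrightarrow>
    (\<exists>L. (essential_parallel_closure M L \<or> locked M L) \<and> C = {x. esum x L \<le> mrank M L}) \<or>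
    (\<exists>L. essential_coparallel_closure M (- L) \<and>
      C = {x. esum x (- L) \<ge> real (mrank M UNIV) - mrank M L})" (is "_ \<longleftrightarrow> ?R")
proof
  assume "C \<in> tree_inequalities G"
  then consider P where "essential_parallel_closure M P" "C = {x. esum x P \<le> 1}"
    | S where "essential_coparallel_closure M S" "C = {x. esum x S \<ge> real (card S) - 1}"
    | H where "locked_subgraph H G" "C = {x. esum x (edges H) \<le> real (card (verts H)) - 1}"
    unfolding tree_inequalities_def by blast
  then show ?R
  proof cases
    case 1
    then show ?thesis using M.flacet_of_parallel_closure(2)[OF 1(1)] by auto
  next
    case 2
    then show ?thesis using rank_coparallel[OF 2(1)] by (intro disjI2 exI[of _ "- S"]) simp
  next
    case 3
    then show ?thesis using locked_subgraphD[OF 3(1)] by auto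
  qed
next
  assume ?R
  then consider L where "essential_parallel_closure M L" "C = {x. esum x L \<le> mrank M L}"
    | L where "locked M L" "C = {x. esum x L \<le> mrank M L}"
    | L where "essential_coparallel_closure M (- L)"
        "C = {x. esum x (- L) \<ge> real (mrank M UNIV) - mrank M L}"
    by blast
  then show "C \<in> tree_inequalities G"
  proof cases
    case 1
    then show ?thesis
      using M.flacet_of_parallel_closure(2)[OF 1(1)] unfolding tree_inequalities_def by auto
  next
    case 2
    then show ?thesis
      using locked_subgraph_of_locked[OF 2(1)] card_verts_locked[OF 2(1)]
      unfolding tree_inequalities_def
      by (intro UnI2 CollectI exI[of _ "\<lparr>verts = (\<Union>e\<in>L. ends G e), edges = L, ends = ends G\<rparr>"]) simp
  next
    case 3
    then show ?thesis
      using rank_coparallel[OF 3(1)] unfolding tree_inequalities_def by auto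
  qed
qed

lemma tree_inequality_cases:
  assumes "C \<in> tree_inequalities G"
  obtains L where "flacet_halfspace M C L" "essential_parallel_closure M L \<or> locked M L"
      "C = {x. esum x L \<le> mrank M L}"
    | L where "flacet_halfspace M C L" "essential_coparallel_closure M (- L)"
      "C = {x. esum x (- L) \<ge> real (mrank M UNIV) - mrank M L}"
proof -
  have "flacet M L" if "essential_coparallel_closure M (- L)" for L
    using M.flacet_of_coparallel_closure(1)[OF that] M.UNIV by (simp add: Compl_eq_Diff_UNIV double_diff)
  then show ?thesis
    using assms that M.flacet_of_parallel_closure(1) M.flacet_of_locked
    unfolding tree_inequalities_iff flacet_halfspace_def by blast
qed

lemma ex_label: "C \<in> tree_inequalities G \<Longrightarrow> \<exists>L. flacet_halfspace M C L"
  by (erule tree_inequality_cases) blast+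

lemma ex_tree_inequality:
  assumes "\<not> digon G" and L: "flacet M L"
  shows "\<exists>C\<in>tree_inequalities G. flacet_halfspace M C L"
proof -
  \<comment> \<open>Rank 1 means two vertices, so the case excluded by \<open>flacet_cases\<close>
    is the digon.\<close>
  have "\<not> (mrank M (ground M) = 1 \<and> card (ground M) = 2)"
    using assms(1) rank_UNIV edges M.UNIV by (auto simp: digon_def)
  from M.flacet_cases[OF two_connected_M L this] show ?thesis
    using L M.UNIV unfolding Bex_def tree_inequalities_iff flacet_halfspace_def
    by (auto simp: Compl_eq_Diff_UNIV)
qed

text \<open>Constraints of the same form for the same flacet coincide. In different forms,
  \<open>L\<close> would be a parallel closure with coparallel complement, which is assumed away, or
  locked, although its complement has dual rank 1.\<close>

lemma same_label_imp_eq: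
  assumes "\<not> complementary_closures G"
    and CD: "C \<in> tree_inequalities G" "D \<in> tree_inequalities G" "flacet_halfspace M C L" "flacet_halfspace M D L"
  shows "C = D"
proof -
  have label: "K = L" if "flacet_halfspace M C K \<or> flacet_halfspace M D K" for K
    using M.flacet_halfspace_unique[OF two_connected_M, of _ K _ L] CD that by blast
  have no: False if "essential_parallel_closure M L \<or> locked M L" "essential_coparallel_closure M (- L)"
    using that(1)
  proof
    assume "essential_parallel_closure M L"
    then show False
      using assms(1) that(2) edges by (auto simp: complementary_closures_def Compl_eq_Diff_UNIV)
  next
    assume "locked M L"
    then show False
      using M.flacet_of_coparallel_closure(3)[OF that(2)] M.UNIV
      by (simp add: locked_def Compl_eq_Diff_UNIV)
  qed
  from CD(1) show ?thesis
  proof (cases rule: tree_inequality_cases)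
    case (1 K)
    from CD(2) show ?thesis
      by (cases rule: tree_inequality_cases) (use 1 label no in blast)+
  next
    case (2 K)
    from CD(2) show ?thesis
      by (cases rule: tree_inequality_cases) (use 2 label no in blast)+
  qed
qed

end

theorem corollary2p4:
  fixes G :: "('v, 'e::finite) multigraph"
  assumes "multigraph G" and "edges G = UNIV"
    and "two_connected_graph G"
    and "\<not> digon G"
  shows "\<Inter>(tree_equations G \<union> tree_inequalities G) = spanning_trees_polytope G \<and>
    (\<not> complementary_closures G \<longrightarrow>
       minimal_description (tree_equations G) (tree_inequalities G) (spanning_trees_polytope G)) \<and>
    (\<forall>J. lists_once (tree_equations G) (tree_inequalities G) J \<longrightarrow>
       minimal_description (tree_equations G) J (spanning_trees_polytope G))"
proof -
  interpret two_connected_multigraph G by unfold_locales (use assms in auto)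
  note all = ex_tree_inequality[OF assms(4)]
  show ?thesis
    unfolding spanning_trees_polytope_eq tree_equations_eq
  proof (intro conjI impI allI)
    show "\<Inter>({{x. esum x UNIV = mrank M UNIV}} \<union> tree_inequalities G) = base_polytope M"
      by (rule M.Inter_flacets[OF two_connected_M ex_label all])
    show "minimal_description {{x. esum x UNIV = mrank M UNIV}} (tree_inequalities G) (base_polytope M)"
      if "\<not> complementary_closures G"
      by (rule M.minimal_description_flacets[OF two_connected_M ex_label all same_label_imp_eq[OF that]])
    fix J
    assume "lists_once {{x. esum x UNIV = mrank M UNIV}} (tree_inequalities G) J"
    then have J: "J \<subseteq> tree_inequalities G"
      and once: "\<And>C. C \<in> tree_inequalities G \<Longrightarrow> \<exists>!D. D \<in> J \<and>
        {x. esum x UNIV = mrank M UNIV} \<inter> D = {x. esum x UNIV = mrank M UNIV} \<inter> C"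
      by (auto simp: lists_once_def)
    show "minimal_description {{x. esum x UNIV = mrank M UNIV}} J (base_polytope M)"
    proof (rule M.minimal_description_flacets[OF two_connected_M])
      show "\<exists>L. flacet_halfspace M C L" if "C \<in> J" for C using ex_label J that by blast
      show "\<exists>D\<in>J. flacet_halfspace M D L" if L: "flacet M L" for L
      proof -
        obtain C where C: "C \<in> tree_inequalities G" "flacet_halfspace M C L" using all[OF L] by blast
        \<comment> \<open>The representative of \<open>C\<close> in \<open>J\<close> has the same
          trace on the hyperplane and therefore the same flacet.\<close>
        obtain D where D: "D \<in> J"
          "{x. esum x UNIV = mrank M UNIV} \<inter> D = {x. esum x UNIV = mrank M UNIV} \<inter> C"
          using once[OF C(1)] by blast
        obtain L' where L': "flacet_halfspace M D L'" using ex_label J D(1) by blast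
        have "L = L'"
          by (rule M.flacet_halfspace_unique[OF two_connected_M C(2) L']) (use D(2) in blast)
        then show ?thesis using D(1) L' by blast
      qed
      fix C D L
      assume CD: "C \<in> J" "D \<in> J" "flacet_halfspace M C L" "flacet_halfspace M D L"
      \<comment> \<open>Two members of \<open>J\<close> with the same flacet have the same trace,
        and \<open>J\<close> contains only one member for each trace.\<close>
      have "{x. esum x UNIV = mrank M UNIV} \<inter> D = {x. esum x UNIV = mrank M UNIV} \<inter> C"
        using M.flacet_halfspace_iff[OF CD(3)] M.flacet_halfspace_iff[OF CD(4)] by blast
      then show "C = D" using once[of C] CD(1,2) J by blast
    qed
  qed
qed

end
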